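(* Let $D\subset\mathbb{R}^n$ be a simply connected open set, let $F=(f_{ij})$ be a solution on $D$ of the $\frac{\mathrm{O}(2n-k,k)}{\mathrm{O}(n)\times\mathrm{O}(n-k,k)}$-system, and let $E$ be an extended frame for $F$. Then: (a) $E(x,0)=\begin{pmatrix} g_1(x)&0\\0&g_2(x)\end{pmatrix}$ with $g_1(x)\in\mathrm{O}(n)$ and $g_2(x)\in\mathrm{O}(n-k,k)$. (b) $\frac{\partial E}{\partial\lambda}E^{-1}\big|_{\lambda=0}$ is of the form $\begin{pmatrix}0&Y\\-JY^T&0\end{pmatrix}$ for some map $Y$ into real $n\times n$ matrices, and $\mathrm{d} Y=-\sum_{i=1}^n g_1e_{ii}Jg_2^{-1}\,\mathrm{d} x_i$. (c) If ${\vec{c}}\in\mathbb{R}^{n-k,k}$ is a constant null vector and $(u_1,\dots,u_n)^T:=Jg_2^{-1}{\vec{c}}$, then on the open set $\{x\in D:\prod_{i=1}^n u_i(x)\neq0\}$, $Y{\vec{c}}$ is a Guichard$_k$ orthogonal co-ordinate system on $\mathbb{R}^n$ whose induced metric is $\sum_{i=1}^n u_i^2\,\mathrm{d} x_i^2$. (d) If $\{{\vec{c}}_1,\dots,{\vec{c}}_n\}$ is a null basis of $\mathbb{R}^{n-k,k}$, then $\{Y{\vec{c}}_1,\dots,Y{\vec{c}}_n\}$ is a Combescure sequence of Guichard$_k$ orthogonal co-ordinate systems on $\mathbb{R}^n$. (e) If moreover $\{{\vec{b}}_1,\dots,{\vec{b}}_n\}$ is another null basis of $\mathbb{R}^{n-k,k}$,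 then $Y(x){\vec{c}}_i\mapsto Y(x){\vec{b}}_j$ is a Combescure transform for all $1\le i,j\le n$.
   Context: Fix integers $n\ge2$ and $1\le k\le n-1$. Let $\epsilon_i=1$ for $1\le i\le n-k$ and $\epsilon_i=-1$ for $n-k<i\le n$, $J=\mathrm{I}_{n-k,k}=\operatorname{diag}(\epsilon_1,\dots,\epsilon_n)$, and $(\vec x,\vec y)_k=\vec x^TJ\vec y$ on $\mathbb{R}^n$ (denoted $\mathbb{R}^{n-k,k}$) and on $\mathbb{C}^n$. A vector ${\vec{c}}$ is null if $({\vec{c}},{\vec{c}})_k=0$; a null basis of $\mathbb{R}^{n-k,k}$ is a basis consisting of null vectors. $\mathrm{O}(n-k,k)=\{g: g^TJg=J\}$. $e_{ii}$ is the $n\times n$ matrix with $1$ in entry $(i,i)$ and $0$ elsewhere; $\delta=\operatorname{diag}(\mathrm{d} x_1,\dots,\mathrm{d} x_n)$. Let $G=\operatorname{diag}(\mathrm{I}_n,J)$ ($2n\times 2n$); $\mathrm{O}(2n-k,k)^{\mathbb{C}}$ is the group of complex $2n\times2n$ matrices $A$ with $A^TGA=G$, and $\mathrm{I}_{n,n}=\operatorname{diag}(\mathrm{I}_n,-\mathrm{I}_n)$. The $\frac{\mathrm{O}(2n-k,k)}{\mathrm{O}(n)\times\mathrm{O}(n-k,k)}$-system is the PDE for a smooth map $F=(f_{ij})$ into real $n\times n$ matrices with $f_{ii}=0$ for all $i$, requiring that the $1$-forms $\omega=-\delta JF+F^TJ\delta$ and $\tau=-\delta F^TJ+F\delta J$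 are both flat ($\mathrm{d}\omega+\omega\wedge\omega=0$, $\mathrm{d}\tau+\tau\wedge\tau=0$); equivalently the family $\theta_\lambda=\begin{pmatrix}\omega&-\lambda\delta J\\ \lambda\delta&\tau\end{pmatrix}$ is flat for all $\lambda\in\mathbb{C}$. An extended frame for $F$ is a smooth map $E:D\times\mathbb{C}\to\mathrm{O}(2n-k,k)^{\mathbb{C}}$, holomorphic in $\lambda$, with $E(\cdot,\lambda)^{-1}\mathrm{d} E(\cdot,\lambda)=\theta_\lambda$ for all $\lambda$, satisfying $\overline{E(x,\bar\lambda)}=E(x,\lambda)$ and $\mathrm{I}_{n,n}E(x,-\lambda)\mathrm{I}_{n,n}^{-1}=E(x,\lambda)$. An orthogonal co-ordinate system on an open set $U\subset\mathbb{R}^n$ is a smooth map $\phi:U\to\mathbb{R}^n$ whose partial derivatives $\phi_{x_1},\dots,\phi_{x_n}$ are nonzero and mutually orthogonal at each point; a metric field for it is $\vec u=(u_1,\dots,u_n)^T$ with $\phi^*(\mathrm{d} s_0^2)=\sum u_i^2\mathrm{d} x_i^2$ ($\mathrm{d} s_0^2$ the Euclidean metric). A diagonal metric $\sum g_{ii}\mathrm{d} x_i^2$ is Guichard$_k$ if $\sum_{i=1}^{n-k}g_{ii}=\sum_{i=n-k+1}^n g_{ii}$; $\phi$ is Guichard$_k$ if $\phi^*(\mathrm{d} s_0^2)$ is. A map $\phi(x)\mapsto\psi(x)$ between orthogonal co-ordinate systems is a Combescure transform if $\phi_{x_i}(x)$ is parallel to $\psi_{x_i}(x)$ for all $i$ and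 $x$. A sequence $\{\phi_1,\dots,\phi_n\}$ of Guichard$_k$ orthogonal co-ordinate systems is a Combescure sequence if (i) each $\phi_i\mapsto\phi_{i+1}$ ($1\le i\le n-1$) is a Combescure transform and (ii) the metric fields $\vec u_i=(u_{i1},\dots,u_{in})^T$ of $\phi_i$, chosen so that $(\phi_i)_{x_j}/u_{ij}=(\phi_1)_{x_j}/u_{1j}$ for all $i,j$, are linearly independent at every point. *)

theory Defs
  imports "HOL-Analysis.Analysis"
begin

(* Index type 'n :: {finite, linorder} models {1..n}, n = CARD('n); the linear order
   fixes which indices are the "first n-k" ones. *)

definition idx :: "('n::{finite,linorder}) \<Rightarrow> nat" where
  "idx i = card {j. j < i}"

definition eps :: "nat \<Rightarrow> ('n::{finite,linorder}) \<Rightarrow> real" where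
  "eps k i = (if idx i < CARD('n) - k then 1 else -1)"

definition Jmat :: "nat \<Rightarrow> real^(('n::{finite,linorder}))^('n::{finite,linorder})" where
  "Jmat k = (\<chi> i j. if i = j then eps k i else 0)"

definition eii :: "'n::finite \<Rightarrow> real^'n^'n" where
  "eii i = (\<chi> a b. if a = i \<and> b = i then 1 else 0)"

definition formk :: "nat \<Rightarrow> real^('n::{finite,linorder}) \<Rightarrow> real^('n::{finite,linorder}) \<Rightarrow> real" where
  "formk k x y = x \<bullet> (Jmat k *v y)"

definition null_vec :: "nat \<Rightarrow> real^('n::{finite,linorder}) \<Rightarrow> bool" where
  "null_vec k c \<longleftrightarrow> formk k c c = 0"

definition null_basis :: "nat \<Rightarrow> (nat \<Rightarrow> real^('n::{finite,linorder})) \<Rightarrow> bool" where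
  "null_basis k c \<longleftrightarrow> (\<forall>i\<in>{1..CARD('n)}. null_vec k (c i)) \<and> inj_on c {1..CARD('n)}
     \<and> independent (c ` {1..CARD('n)}) \<and> span (c ` {1..CARD('n)}) = UNIV"

definition O_indef :: "nat \<Rightarrow> real^(('n::{finite,linorder}))^('n::{finite,linorder}) \<Rightarrow> bool" where
  "O_indef k g \<longleftrightarrow> transpose g ** Jmat k ** g = Jmat k"

definition cmat :: "real^'m^'n \<Rightarrow> complex^'m^'n" where
  "cmat A = (\<chi> i j. complex_of_real (A $ i $ j))"

definition blk :: "'a^'n^'n \<Rightarrow> 'a^'n^'n \<Rightarrow> 'a^'n^'n \<Rightarrow> 'a^'n^'n \<Rightarrow> 'a^('n+'n)^('n+'n)" where
  "blk A B C D = (\<chi> p q. case p of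
      Inl i \<Rightarrow> (case q of Inl j \<Rightarrow> A $ i $ j | Inr j \<Rightarrow> B $ i $ j)
    | Inr i \<Rightarrow> (case q of Inl j \<Rightarrow> C $ i $ j | Inr j \<Rightarrow> D $ i $ j))"

definition Gmat :: "nat \<Rightarrow> complex^(('n::{finite,linorder})+('n::{finite,linorder}))^(('n::{finite,linorder})+('n::{finite,linorder}))" where
  "Gmat k = blk (mat 1) 0 0 (cmat (Jmat k))"

definition O_cplx :: "nat \<Rightarrow> complex^(('n::{finite,linorder})+('n::{finite,linorder}))^(('n::{finite,linorder})+('n::{finite,linorder})) \<Rightarrow> bool" where
  "O_cplx k A \<longleftrightarrow> transpose A ** Gmat k ** A = Gmat k"

definition Inn :: "complex^('n::finite+'n)^('n+'n)" where
  "Inn = blk (mat 1) 0 0 (- mat 1)"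

definition pder :: "(real^'n \<Rightarrow> 'b::real_normed_vector) \<Rightarrow> real^'n \<Rightarrow> 'n \<Rightarrow> 'b" where
  "pder f x i = frechet_derivative f (at x) (axis i 1)"

fun iter_der :: "'a list \<Rightarrow> ('a::real_normed_vector \<Rightarrow> 'b::real_normed_vector) \<Rightarrow> 'a \<Rightarrow> 'b" where
  "iter_der [] f = f"
| "iter_der (v # vs) f = (\<lambda>x. frechet_derivative (iter_der vs f) (at x) v)"

definition smooth_on :: "'a::real_normed_vector set \<Rightarrow> ('a \<Rightarrow> 'b::real_normed_vector) \<Rightarrow> bool" where
  "smooth_on S f \<longleftrightarrow> (\<forall>vs. iter_der vs f differentiable_on S)"

(* flatness d A + A \<and> A = 0 of the matrix-valued 1-form A = sum_i A_i dx_i, written out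
   in coordinates *)
definition flat_form :: "(real^'n) set \<Rightarrow> ('n \<Rightarrow> real^'n \<Rightarrow> 'a::{real_normed_vector,semiring_1}^'m^'m) \<Rightarrow> bool" where
  "flat_form D A \<longleftrightarrow> (\<forall>x\<in>D. \<forall>i j. pder (A j) x i - pder (A i) x j + A i x ** A j x - A j x ** A i x = 0)"

(* coefficients of dx_i in omega = -\<delta>JF + F^T J \<delta> and tau = -\<delta>F^T J + F \<delta> J *)
definition omega_coef :: "nat \<Rightarrow> real^(('n::{finite,linorder}))^('n::{finite,linorder}) \<Rightarrow> ('n::{finite,linorder}) \<Rightarrow> real^('n::{finite,linorder})^('n::{finite,linorder})" where
  "omega_coef k F i = - (eii i ** Jmat k ** F) + transpose F ** Jmat k ** eii i"

definition tau_coef :: "nat \<Rightarrow> real^(('n::{finite,linorder}))^('n::{finite,linorder}) \<Rightarrow> ('n::{finite,linorder}) \<Rightarrow> real^('n::{finite,linorder})^('n::{finite,linorder})" where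
  "tau_coef k F i = - (eii i ** transpose F ** Jmat k) + F ** eii i ** Jmat k"

definition theta_coef :: "nat \<Rightarrow> real^(('n::{finite,linorder}))^('n::{finite,linorder}) \<Rightarrow> complex \<Rightarrow> ('n::{finite,linorder}) \<Rightarrow> complex^(('n::{finite,linorder})+('n::{finite,linorder}))^(('n::{finite,linorder})+('n::{finite,linorder}))" where
  "theta_coef k F l i = blk (cmat (omega_coef k F i)) (mat (- l) ** cmat (eii i ** Jmat k))
                            (mat l ** cmat (eii i)) (cmat (tau_coef k F i))"

definition is_system_solution :: "nat \<Rightarrow> (real^('n::{finite,linorder})) set \<Rightarrow> (real^('n::{finite,linorder}) \<Rightarrow> real^('n::{finite,linorder})^('n::{finite,linorder})) \<Rightarrow> bool" where
  "is_system_solution k D F \<longleftrightarrow> smooth_on D F \<and> (\<forall>x\<in>D. \<forall>i. F x $ i $ i = 0)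
     \<and> flat_form D (\<lambda>i x. omega_coef k (F x) i) \<and> flat_form D (\<lambda>i x. tau_coef k (F x) i)"

definition extended_frame :: "nat \<Rightarrow> (real^('n::{finite,linorder})) set \<Rightarrow> (real^('n::{finite,linorder}) \<Rightarrow> real^('n::{finite,linorder})^('n::{finite,linorder}))
     \<Rightarrow> (real^('n::{finite,linorder}) \<Rightarrow> complex \<Rightarrow> complex^(('n::{finite,linorder})+('n::{finite,linorder}))^(('n::{finite,linorder})+('n::{finite,linorder}))) \<Rightarrow> bool" where
  "extended_frame k D F E \<longleftrightarrow>
     smooth_on (D \<times> UNIV) (\<lambda>(x, l). E x l)
   \<and> (\<forall>x\<in>D. \<forall>a b. (\<lambda>l. E x l $ a $ b) holomorphic_on UNIV)
   \<and> (\<forall>x\<in>D. \<forall>l. O_cplx k (E x l))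
   \<and> (\<forall>x\<in>D. \<forall>l. \<forall>i. matrix_inv (E x l) ** pder (\<lambda>y. E y l) x i = theta_coef k (F x) l i)
   \<and> (\<forall>x\<in>D. \<forall>l. (\<chi> a b. cnj (E x (cnj l) $ a $ b)) = E x l)
   \<and> (\<forall>x\<in>D. \<forall>l. Inn ** E x (- l) ** matrix_inv Inn = E x l)"

definition dlam :: "(real^'n \<Rightarrow> complex \<Rightarrow> complex^'m^'m) \<Rightarrow> real^'n \<Rightarrow> complex^'m^'m" where
  "dlam E x = (\<chi> a b. deriv (\<lambda>l. E x l $ a $ b) 0)"

definition orth_coord :: "(real^'n) set \<Rightarrow> (real^'n \<Rightarrow> real^'n) \<Rightarrow> bool" where
  "orth_coord U \<phi> \<longleftrightarrow> open U \<and> smooth_on U \<phi> \<and> (\<forall>x\<in>U. \<forall>i. pder \<phi> x i \<noteq> 0)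
     \<and> (\<forall>x\<in>U. \<forall>i j. i \<noteq> j \<longrightarrow> pder \<phi> x i \<bullet> pder \<phi> x j = 0)"

definition metric_field :: "(real^'n) set \<Rightarrow> (real^'n \<Rightarrow> real^'n) \<Rightarrow> (real^'n \<Rightarrow> real^'n) \<Rightarrow> bool" where
  "metric_field U \<phi> u \<longleftrightarrow>
     (\<forall>x\<in>U. \<forall>i j. pder \<phi> x i \<bullet> pder \<phi> x j = (if i = j then (u x $ i)\<^sup>2 else 0))"

(* a diagonal metric sum g_ii dx_i^2 (coefficients g) is Guichard_k *)
definition guichard_metric :: "nat \<Rightarrow> (('n::{finite,linorder}) \<Rightarrow> real) \<Rightarrow> bool" where
  "guichard_metric k g \<longleftrightarrow>
     (\<Sum>i\<in>{i. idx i < CARD('n) - k}. g i) = (\<Sum>i\<in>{i. CARD('n) - k \<le> idx i}. g i)"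

definition guichard_coord :: "nat \<Rightarrow> (real^('n::{finite,linorder})) set \<Rightarrow> (real^('n::{finite,linorder}) \<Rightarrow> real^('n::{finite,linorder})) \<Rightarrow> bool" where
  "guichard_coord k U \<phi> \<longleftrightarrow> (\<forall>x\<in>U. guichard_metric k (\<lambda>i. pder \<phi> x i \<bullet> pder \<phi> x i))"

definition parallel :: "real^'n \<Rightarrow> real^'n \<Rightarrow> bool" where
  "parallel v w \<longleftrightarrow> (\<exists>a. w = a *\<^sub>R v)"

definition combescure :: "(real^'n) set \<Rightarrow> (real^'n \<Rightarrow> real^'n) \<Rightarrow> (real^'n \<Rightarrow> real^'n) \<Rightarrow> bool" where
  "combescure U \<phi> \<psi> \<longleftrightarrow> orth_coord U \<phi> \<and> orth_coord U \<psi>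
     \<and> (\<forall>x\<in>U. \<forall>j. parallel (pder \<phi> x j) (pder \<psi> x j))"

definition combescure_seq :: "nat \<Rightarrow> nat \<Rightarrow> (real^('n::{finite,linorder})) set \<Rightarrow> (nat \<Rightarrow> real^('n::{finite,linorder}) \<Rightarrow> real^('n::{finite,linorder})) \<Rightarrow> bool" where
  "combescure_seq k m U \<phi> \<longleftrightarrow>
     (\<forall>i\<in>{1..m}. orth_coord U (\<phi> i) \<and> guichard_coord k U (\<phi> i))
   \<and> (\<forall>i. 1 \<le> i \<and> i < m \<longrightarrow> combescure U (\<phi> i) (\<phi> (Suc i)))
   \<and> (\<exists>u.
        (\<forall>i\<in>{1..m}. metric_field U (\<phi> i) (u i))
      \<and> (\<forall>i\<in>{1..m}. \<forall>x\<in>U. \<forall>j. inverse (u i x $ j) *\<^sub>R pder (\<phi> i) x j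
                                 = inverse (u 1 x $ j) *\<^sub>R pder (\<phi> 1) x j)
      \<and> (\<forall>x\<in>U. inj_on (\<lambda>i. u i x) {1..m} \<and> independent ((\<lambda>i. u i x) ` {1..m})))"

definition nondeg_set :: "nat \<Rightarrow> (real^('n::{finite,linorder})) set \<Rightarrow> (real^('n::{finite,linorder}) \<Rightarrow> real^('n::{finite,linorder})^('n::{finite,linorder})) \<Rightarrow> (real^('n::{finite,linorder})) set \<Rightarrow> (real^('n::{finite,linorder})) set" where
  "nondeg_set k D g2 V = {x\<in>D. \<forall>c\<in>V. (\<Prod>i\<in>UNIV. (Jmat k ** matrix_inv (g2 x) *v c) $ i) \<noteq> 0}"

end

theory Submission
  imports Defs
begin

text \<open>Reality and the reflection \<open>\<lambda> \<mapsto> - \<lambda>\<close> make \<open>E\<close> block diagonal and \<open>\<partial>E/\<partial>\<lambda>\<close> block off-diagonal at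
  \<open>\<lambda> = 0\<close>. Put \<open>M = (\<partial>E/\<partial>\<lambda>) E\<^sup>-\<^sup>1\<close> at \<open>\<lambda> = 0\<close>; it is skew for \<open>G\<close>, which gives its two blocks from
  the one block \<open>Y\<close>. Commuting the partial derivatives in \<open>\<lambda>\<close> and \<open>x\<^sub>i\<close> gives
  \<open>\<partial>M/\<partial>x\<^sub>i = E (\<partial>\<theta>\<^sub>i/\<partial>\<lambda>) E\<^sup>-\<^sup>1\<close>, hence \<open>\<partial>(Y c)/\<partial>x\<^sub>i = - u\<^sub>i g\<^sub>1 e\<^sub>i\<close> with \<open>u = J g\<^sub>2\<^sup>-\<^sup>1 c\<close>. As \<open>g\<^sub>1\<close> is orthogonal
  and \<open>g\<^sub>2\<close> preserves the indefinite form, these directions are orthonormal and independent of \<open>c\<close>,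
  and nullity of \<open>c\<close> is the Guichard condition.\<close>

section \<open>Smooth maps\<close>

text \<open>The mean value theorem in direction \<open>u\<close>, applied to a difference in
  direction \<open>v\<close>, reduces the second difference to \<open>h * (G p - G q)\<close>.
  Differentiability of \<open>G\<close> at the single point \<open>x\<close> then evaluates it, so
  the argument does not pass through continuity of second derivatives.\<close>

lemma second_difference_estimate:
  fixes f :: "'a::real_normed_vector \<Rightarrow> real"
  assumes S: "open S" "x \<in> S"
    and f: "\<And>y. y \<in> S \<Longrightarrow> f differentiable (at y)"
    and g: "((\<lambda>y. frechet_derivative f (at y) u) has_derivative g') (at x)"
    and e: "e > 0"
  shows "\<exists>d>0. \<forall>h. 0 < h \<and> h < d \<longrightarrow>
    \<bar>f (x + h *\<^sub>R u + h *\<^sub>R v) - f (x + h *\<^sub>R u) - f (x + h *\<^sub>R v) + f x - h^2 * g' v\<bar> \<le> e * h^2"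
proof -
  define G where "G = (\<lambda>y. frechet_derivative f (at y) u)"
  \<comment> \<open>\<open>h * (C - 1)\<close> bounds the sum of the distances from \<open>x\<close>
    to the two points \<open>p\<close> and \<open>q\<close> where \<open>G\<close> is compared; the
    extra 1 keeps \<open>C\<close> positive.\<close>
  define C where "C = 2 * norm u + norm v + 1"
  have C: "C > 0" by (simp add: C_def add_nonneg_pos)
  interpret g': bounded_linear g' using g has_derivative_bounded_linear by blast
  have eC: "e / C > 0" using e C by simp
  obtain r where r: "r > 0" "ball x r \<subseteq> S" using S openE by blast
  obtain s where s: "s > 0"
    and sG: "\<And>y. norm (y - x) < s \<Longrightarrow> norm (G y - G x - g' (y - x)) \<le> e / C * norm (y - x)"
    using g eC unfolding has_derivative_at_alt G_def by blast
  \<comment> \<open>With \<open>h < d\<close> one has \<open>h * C < min r s\<close>, so all points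
    used below lie in \<open>S\<close> and in the range where the linear approximation of
    \<open>G\<close> is valid.\<close>
  define d where "d = min r s / C"
  have d: "d > 0" using r s C by (simp add: d_def)
  have "\<bar>f (x + h *\<^sub>R u + h *\<^sub>R v) - f (x + h *\<^sub>R u) - f (x + h *\<^sub>R v) + f x - h^2 * g' v\<bar> \<le> e * h^2"
    if h: "0 < h" "h < d" for h
  proof -
    have hC: "h * C < min r s" using h C by (simp add: d_def pos_less_divide_eq)
    have n1: "norm (t *\<^sub>R u + h *\<^sub>R v) \<le> h * (norm u + norm v)" if "0 \<le> t" "t \<le> h" for t
    proof -
      have "norm (t *\<^sub>R u + h *\<^sub>R v) \<le> t * norm u + h * norm v"
        using norm_triangle_ineq[of "t *\<^sub>R u" "h *\<^sub>R v"] that h by simp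
      also have "\<dots> \<le> h * norm u + h * norm v" using that by (simp add: mult_right_mono)
      finally show ?thesis by (simp add: algebra_simps)
    qed
    have n2: "norm (t *\<^sub>R u) \<le> h * norm u" if "0 \<le> t" "t \<le> h" for t
      using that by (simp add: mult_right_mono)
    have "h * (norm u + norm v) \<le> h * C" "h * norm u \<le> h * C"
      using h by (auto simp: C_def intro!: mult_left_mono)
    then have n1': "norm (t *\<^sub>R u + h *\<^sub>R v) < min r s" and n2': "norm (t *\<^sub>R u) < min r s"
      if "0 \<le> t" "t \<le> h" for t
      using n1[OF that] n2[OF that] hC by linarith+
    have inS: "x + t *\<^sub>R u + h *\<^sub>R v \<in> S" "x + t *\<^sub>R u \<in> S" if "0 \<le> t" "t \<le> h" for t
    proof -
      have "x + w \<in> S" if "norm w < min r s" for w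
        using that r(2) by (auto simp: subset_iff dist_norm)
      from this[OF n1'[OF that]] this[OF n2'[OF that]]
      show "x + t *\<^sub>R u + h *\<^sub>R v \<in> S" "x + t *\<^sub>R u \<in> S" by (simp_all add: add.assoc)
    qed
    have fD: "((\<lambda>t. f (p + t *\<^sub>R u)) has_derivative (\<lambda>k. k * G (p + t *\<^sub>R u))) (at t)"
      if "p + t *\<^sub>R u \<in> S" for p t
    proof -
      have 1: "(f has_derivative frechet_derivative f (at (p + t *\<^sub>R u))) (at (p + t *\<^sub>R u))"
        using f[OF that] frechet_derivative_works by blast
      have 2: "((\<lambda>t. p + t *\<^sub>R u) has_derivative (\<lambda>k. k *\<^sub>R u)) (at t)"
        by (auto intro!: derivative_eq_intros)
      have "frechet_derivative f (at (p + t *\<^sub>R u)) (k *\<^sub>R u) = k * G (p + t *\<^sub>R u)" for k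
        using linear_scale[OF linear_frechet_derivative[OF f[OF that]]] by (simp only: G_def real_scaleR_def)
      then show ?thesis using has_derivative_compose[OF 2 1] by simp
    qed
    \<comment> \<open>The second difference is \<open>\<phi> h - \<phi> 0\<close>, which makes the
      one-variable mean value theorem applicable.\<close>
    define \<phi> where "\<phi> = (\<lambda>t. f (x + h *\<^sub>R v + t *\<^sub>R u) - f (x + t *\<^sub>R u))"
    have inS': "x + h *\<^sub>R v + t *\<^sub>R u \<in> S" if "0 \<le> t" "t \<le> h" for t
      using inS(1)[OF that] by (simp add: algebra_simps)
    have "\<exists>t\<in>{0<..<h}. \<phi> h - \<phi> 0 =
        (\<lambda>k. k * G (x + h *\<^sub>R v + t *\<^sub>R u) - k * G (x + t *\<^sub>R u)) (h - 0)"
    proof (rule mvt_simple)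
      fix t assume t: "0 \<le> t" "t \<le> h"
      show "(\<phi> has_derivative (\<lambda>k. k * G (x + h *\<^sub>R v + t *\<^sub>R u) - k * G (x + t *\<^sub>R u))) (at t within {0..h})"
        unfolding \<phi>_def
        using has_derivative_diff[OF fD[OF inS'[OF t]] fD[OF inS(2)[OF t]]] has_derivative_at_withinI by blast
    qed (use h in simp)
    then obtain t where t: "0 < t" "t < h"
      and eq: "\<phi> h - \<phi> 0 = h * (G (x + h *\<^sub>R v + t *\<^sub>R u) - G (x + t *\<^sub>R u))"
      by (auto simp: algebra_simps)
    have t': "0 \<le> t" "t \<le> h" using t by auto
    define p q where "p = x + h *\<^sub>R v + t *\<^sub>R u" and "q = x + t *\<^sub>R u"
    have px: "p - x = t *\<^sub>R u + h *\<^sub>R v" and qx: "q - x = t *\<^sub>R u" by (simp_all add: p_def q_def)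
    have gp: "\<bar>G p - G x - g' (p - x)\<bar> \<le> e / C * (h * (norm u + norm v))"
    proof -
      have "\<bar>G p - G x - g' (p - x)\<bar> \<le> e / C * norm (p - x)"
        using sG[of p] n1'[OF t'] by (simp add: px)
      also have "\<dots> \<le> e / C * (h * (norm u + norm v))"
        using n1[OF t'] eC by (intro mult_left_mono) (auto simp: px)
      finally show ?thesis .
    qed
    have gq: "\<bar>G q - G x - g' (q - x)\<bar> \<le> e / C * (h * norm u)"
    proof -
      have "\<bar>G q - G x - g' (q - x)\<bar> \<le> e / C * norm (q - x)"
        using sG[of q] n2'[OF t'] by (simp add: qx)
      also have "\<dots> \<le> e / C * (h * norm u)"
        using n2[OF t'] eC by (intro mult_left_mono) (auto simp: qx)
      finally show ?thesis .
    qed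
    have "g' (p - x) - g' (q - x) = h * g' v"
      by (simp add: px qx g'.add g'.scaleR)
    then have "\<bar>G p - G q - h * g' v\<bar> \<le> e / C * (h * (norm u + norm v)) + e / C * (h * norm u)"
      using gp gq by linarith
    also have "\<dots> = e / C * (h * (norm u + norm v + norm u))" by (simp only: distrib_left)
    also have "\<dots> = e / C * (h * (C - 1))" by (simp add: C_def)
    also have "\<dots> \<le> e / C * (h * C)" using eC h by (intro mult_left_mono) auto
    also have "\<dots> = e * h" using C by simp
    finally have G: "\<bar>G p - G q - h * g' v\<bar> \<le> e * h" .
    have "f (x + h *\<^sub>R u + h *\<^sub>R v) - f (x + h *\<^sub>R u) - f (x + h *\<^sub>R v) + f x - h^2 * g' v
        = h * (G p - G q - h * g' v)"
      using eq by (simp add: \<phi>_def p_def q_def algebra_simps power2_eq_square)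
    also have "\<bar>\<dots>\<bar> \<le> h * (e * h)"
      using G h by (simp add: abs_mult mult_left_mono)
    finally show ?thesis by (simp add: power2_eq_square algebra_simps)
  qed
  then show ?thesis using d by blast
qed

text \<open>The second difference is symmetric in \<open>u\<close> and \<open>v\<close>, so
  \<open>h^2 * gu v\<close> and \<open>h^2 * gv u\<close> both approximate the same number with
  error \<open>e * h^2\<close>. Dividing by \<open>h^2\<close> leaves an arbitrarily small
  gap.\<close>

lemma frechet_derivative_swap_real:
  fixes f :: "'a::real_normed_vector \<Rightarrow> real"
  assumes S: "open S" "x \<in> S"
    and f: "\<And>y. y \<in> S \<Longrightarrow> f differentiable (at y)"
    and gu: "((\<lambda>y. frechet_derivative f (at y) u) has_derivative gu) (at x)"
    and gv: "((\<lambda>y. frechet_derivative f (at y) v) has_derivative gv) (at x)"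
  shows "gu v = gv u"
proof -
  have le: "\<bar>gu v - gv u\<bar> \<le> 2 * e" if e: "e > 0" for e
  proof -
    obtain d1 where d1: "d1 > 0" and b1: "\<And>h. 0 < h \<Longrightarrow> h < d1 \<Longrightarrow>
      \<bar>f (x + h *\<^sub>R u + h *\<^sub>R v) - f (x + h *\<^sub>R u) - f (x + h *\<^sub>R v) + f x - h^2 * gu v\<bar> \<le> e * h^2"
      using second_difference_estimate[OF S f gu e, of v] by blast
    obtain d2 where d2: "d2 > 0" and b2: "\<And>h. 0 < h \<Longrightarrow> h < d2 \<Longrightarrow>
      \<bar>f (x + h *\<^sub>R v + h *\<^sub>R u) - f (x + h *\<^sub>R v) - f (x + h *\<^sub>R u) + f x - h^2 * gv u\<bar> \<le> e * h^2"
      using second_difference_estimate[OF S f gv e, of u] by blast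
    define h where "h = min d1 d2 / 2"
    have h: "0 < h" "h < d1" "h < d2" using d1 d2 by (auto simp: h_def)
    have sw: "x + h *\<^sub>R v + h *\<^sub>R u = x + h *\<^sub>R u + h *\<^sub>R v" by simp
    have "\<bar>h^2 * gu v - h^2 * gv u\<bar> \<le> 2 * (e * h^2)"
      using b1[OF h(1,2)] b2[OF h(1,3)] unfolding sw by linarith
    moreover have "\<bar>h^2 * gu v - h^2 * gv u\<bar> = h^2 * \<bar>gu v - gv u\<bar>"
      by (simp add: abs_mult flip: right_diff_distrib)
    ultimately have "h^2 * \<bar>gu v - gv u\<bar> \<le> h^2 * (2 * e)" by (simp add: mult_ac)
    then show ?thesis using h by simp
  qed
  have "\<bar>gu v - gv u\<bar> \<le> 0"
  proof (rule field_le_epsilon)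
    fix e :: real assume "e > 0"
    then show "\<bar>gu v - gv u\<bar> \<le> 0 + e" using le[of "e / 2"] by simp
  qed
  then show ?thesis by simp
qed

text \<open>Pairing with an arbitrary vector \<open>w\<close> reduces the claim to real-valued
  functions, and the inner product separates points.\<close>

lemma frechet_derivative_swap:
  fixes f :: "'a::real_normed_vector \<Rightarrow> 'b::real_inner"
  assumes S: "open S" "x \<in> S"
    and f: "\<And>y. y \<in> S \<Longrightarrow> f differentiable (at y)"
    and gu: "((\<lambda>y. frechet_derivative f (at y) u) has_derivative gu) (at x)"
    and gv: "((\<lambda>y. frechet_derivative f (at y) v) has_derivative gv) (at x)"
  shows "gu v = gv u"
proof -
  have "gu v \<bullet> w = gv u \<bullet> w" for w
  proof -
    have fw: "((\<lambda>y. f y \<bullet> w) has_derivative (\<lambda>h. frechet_derivative f (at y) h \<bullet> w)) (at y)"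
      if "y \<in> S" for y
      using f[OF that] frechet_derivative_works has_derivative_inner_left by blast
    have eq: "frechet_derivative (\<lambda>y. f y \<bullet> w) (at y) = (\<lambda>h. frechet_derivative f (at y) h \<bullet> w)"
      if "y \<in> S" for y
      using frechet_derivative_at[OF fw[OF that]] by simp
    have d: "(\<lambda>y. f y \<bullet> w) differentiable (at y)" if "y \<in> S" for y
      using fw[OF that] differentiable_def by blast
    have tr: "((\<lambda>y. frechet_derivative (\<lambda>y. f y \<bullet> w) (at y) a) has_derivative (\<lambda>h. g h \<bullet> w)) (at x)"
      if "((\<lambda>y. frechet_derivative f (at y) a) has_derivative g) (at x)" for a g
      by (rule has_derivative_transform_within_open[OF has_derivative_inner_left[OF that] S])
         (simp add: eq)
    show ?thesis
      using frechet_derivative_swap_real[OF S d tr[OF gu] tr[OF gv]] by simp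
  qed
  then show ?thesis by (metis inner_eq_zero_iff inner_diff_left right_minus_eq)
qed

section \<open>Smoothness through closure under directional derivatives\<close>

lemma iter_der_append: "iter_der (vs @ ws) f = iter_der vs (iter_der ws f)"
  by (induction vs) auto

lemma smooth_on_differentiable:
  assumes "smooth_on S f" "open S" "x \<in> S"
  shows "f differentiable (at x)"
proof -
  have "iter_der [] f differentiable_on S" using assms(1) unfolding smooth_on_def by blast
  then show ?thesis using assms by (simp add: differentiable_on_eq_differentiable_at)
qed

lemma smooth_on_iter_der: "smooth_on S f \<Longrightarrow> smooth_on S (iter_der ws f)"
  by (auto simp: smooth_on_def simp flip: iter_der_append)

lemma smooth_on_subset: "smooth_on S f \<Longrightarrow> T \<subseteq> S \<Longrightarrow> smooth_on T f"
  unfolding smooth_on_def using differentiable_on_subset by blast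

text \<open>Smoothness quantifies over all lists of directions; a class \<open>P\<close> of
  differentiable functions closed under directional derivatives settles all lists at once. Closure
  is asked only up to equality on \<open>S\<close>, and openness of \<open>S\<close> lets
  derivatives pass through such an equality.\<close>

lemma smooth_on_coinduct:
  assumes S: "open S" and Pf: "P f"
    and diff: "\<And>g x. P g \<Longrightarrow> x \<in> S \<Longrightarrow> g differentiable (at x)"
    and step: "\<And>g v. P g \<Longrightarrow> \<exists>g'. P g' \<and> (\<forall>x\<in>S. frechet_derivative g (at x) v = g' x)"
  shows "smooth_on S f"
proof -
  have ex: "\<exists>g. P g \<and> (\<forall>x\<in>S. g x = iter_der vs f x)" for vs
  proof (induction vs)
    case (Cons v vs)
    then obtain g where g: "P g" "\<And>x. x \<in> S \<Longrightarrow> g x = iter_der vs f x" by blast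
    obtain g' where g': "P g'" "\<And>x. x \<in> S \<Longrightarrow> frechet_derivative g (at x) v = g' x"
      using step[OF g(1)] by blast
    have "g' x = iter_der (v # vs) f x" if "x \<in> S" for x
      using frechet_derivative_transform_within_open[OF diff[OF g(1) that] S that g(2)] g'(2)[OF that]
      by simp
    then show ?case using g'(1) by blast
  qed (use Pf in auto)
  have "iter_der vs f differentiable (at x)" if "x \<in> S" for vs x
  proof -
    obtain g where g: "P g" "\<And>y. y \<in> S \<Longrightarrow> g y = iter_der vs f y" using ex by blast
    show ?thesis
      using diff[OF g(1) that] has_derivative_transform_within_open[where f = g, OF _ S that g(2)]
      unfolding differentiable_def by blast
  qed
  then show ?thesis
    using S by (simp add: smooth_on_def differentiable_on_eq_differentiable_at)
qed

lemma smooth_on_has_derivative: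
  assumes "smooth_on S f" "open S" "x \<in> S"
  shows "(f has_derivative frechet_derivative f (at x)) (at x)"
  using smooth_on_differentiable[OF assms] frechet_derivative_works by blast

lemma smooth_on_frechet_derivative:
  "smooth_on S f \<Longrightarrow> smooth_on S (\<lambda>x. frechet_derivative f (at x) v)"
  using smooth_on_iter_der[of S f "[v]"] by simp

text \<open>The coinductive class consists of all functions that agree on \<open>S\<close> with some
  smooth function.\<close>

lemma smooth_on_cong:
  assumes S: "open S" and eq: "\<And>x. x \<in> S \<Longrightarrow> f x = g x" and f: "smooth_on S f"
  shows "smooth_on S g"
proof (rule smooth_on_coinduct[where P = "\<lambda>g. \<exists>f. smooth_on S f \<and> (\<forall>x\<in>S. f x = g x)", OF S])
  fix g x assume "\<exists>f. smooth_on S f \<and> (\<forall>x\<in>S. f x = g x)" and x: "x \<in> S"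
  then obtain f where f: "smooth_on S f" "\<And>x. x \<in> S \<Longrightarrow> f x = g x" by blast
  show "g differentiable (at x)"
    using has_derivative_transform_within_open[OF smooth_on_has_derivative[OF f(1) S x] S x f(2)]
    unfolding differentiable_def by blast
next
  fix g v assume "\<exists>f. smooth_on S f \<and> (\<forall>x\<in>S. f x = g x)"
  then obtain f where f: "smooth_on S f" "\<And>x. x \<in> S \<Longrightarrow> f x = g x" by blast
  have "frechet_derivative f (at x) = frechet_derivative g (at x)" if "x \<in> S" for x
    using frechet_derivative_transform_within_open[OF smooth_on_differentiable[OF f(1) S that] S that f(2)] .
  then show "\<exists>g'. (\<exists>f. smooth_on S f \<and> (\<forall>x\<in>S. f x = g' x)) \<and> (\<forall>x\<in>S. frechet_derivative g (at x) v = g' x)"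
    using smooth_on_frechet_derivative[OF f(1)] by metis
qed (use eq f in blast)

lemma smooth_on_bounded_linear:
  assumes L: "bounded_linear L" and S: "open S" and f: "smooth_on S f"
  shows "smooth_on S (\<lambda>x. L (f x))"
proof (rule smooth_on_coinduct[where P = "\<lambda>g. \<exists>f. smooth_on S f \<and> g = (\<lambda>x. L (f x))", OF S])
  have D: "((\<lambda>x. L (f x)) has_derivative (\<lambda>h. L (frechet_derivative f (at x) h))) (at x)"
    if "smooth_on S f" "x \<in> S" for f x
    by (rule bounded_linear.has_derivative[OF L smooth_on_has_derivative[OF that(1) S that(2)]])
  fix g assume "\<exists>f. smooth_on S f \<and> g = (\<lambda>x. L (f x))"
  then obtain f where f: "smooth_on S f" and g: "g = (\<lambda>x. L (f x))" by blast
  show "g differentiable (at x)" if "x \<in> S" for x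
    using D[OF f that] unfolding g differentiable_def by blast
  fix v
  have "frechet_derivative g (at x) v = L (frechet_derivative f (at x) v)" if "x \<in> S" for x
    using frechet_derivative_at[OF D[OF f that]] unfolding g by metis
  then show "\<exists>g'. (\<exists>f. smooth_on S f \<and> g' = (\<lambda>x. L (f x))) \<and> (\<forall>x\<in>S. frechet_derivative g (at x) v = g' x)"
    using smooth_on_frechet_derivative[OF f] by blast
qed (use f in blast)

text \<open>The derivative of \<open>f\<close> after \<open>L\<close> in direction \<open>v\<close>
  is the derivative of \<open>f\<close> in the fixed direction \<open>L v\<close>, again composed
  with \<open>L\<close>; hence such composites form a closed class.\<close>

lemma smooth_on_compose_bounded_linear:
  assumes L: "bounded_linear L" and S: "open S" and T: "open T" "L ` T \<subseteq> S" and f: "smooth_on S f"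
  shows "smooth_on T (\<lambda>x. f (L x))"
proof (rule smooth_on_coinduct[where P = "\<lambda>g. \<exists>f. smooth_on S f \<and> g = (\<lambda>x. f (L x))", OF T(1)])
  have D: "((\<lambda>x. f (L x)) has_derivative (\<lambda>h. frechet_derivative f (at (L x)) (L h))) (at x)"
    if "smooth_on S f" "x \<in> T" for f x
    using has_derivative_compose[OF bounded_linear_imp_has_derivative[OF L]
        smooth_on_has_derivative[OF that(1) S, of "L x"]] that(2) T(2) by blast
  fix g assume "\<exists>f. smooth_on S f \<and> g = (\<lambda>x. f (L x))"
  then obtain f where f: "smooth_on S f" and g: "g = (\<lambda>x. f (L x))" by blast
  show "g differentiable (at x)" if "x \<in> T" for x
    using D[OF f that] unfolding g differentiable_def by blast
  fix v
  have "frechet_derivative g (at x) v = frechet_derivative f (at (L x)) (L v)" if "x \<in> T" for x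
    using frechet_derivative_at[OF D[OF f that]] unfolding g by metis
  then show "\<exists>g'. (\<exists>f. smooth_on S f \<and> g' = (\<lambda>x. f (L x))) \<and> (\<forall>x\<in>T. frechet_derivative g (at x) v = g' x)"
    using smooth_on_frechet_derivative[OF f, of "L v"]
    by (intro exI[of _ "\<lambda>x. frechet_derivative f (at (L x)) (L v)"]) blast
qed (use f in blast)

text \<open>Unlike the single products, the finite sums of products of smooth functions are closed
  under directional derivatives.\<close>

inductive smooth_bilinear_sum for S and B :: "'b::real_normed_vector \<Rightarrow> 'c::real_normed_vector \<Rightarrow> 'd::real_normed_vector"
  where
    prod: "smooth_on S f \<Longrightarrow> smooth_on S g \<Longrightarrow> smooth_bilinear_sum S B (\<lambda>x. B (f x) (g x))"
  | add: "smooth_bilinear_sum S B f \<Longrightarrow> smooth_bilinear_sum S B g \<Longrightarrow> smooth_bilinear_sum S B (\<lambda>x. f x + g x)"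

text \<open>The product rule turns each generator into a sum of two generators, and the derivative
  is additive; this is the closure needed by \<open>smooth_on_coinduct\<close>.\<close>

lemma smooth_bilinear_sum_derivative:
  assumes B: "bounded_bilinear B" and S: "open S" and f: "smooth_bilinear_sum S B f"
  shows "(\<forall>x\<in>S. f differentiable (at x)) \<and>
    (\<forall>v. \<exists>g. smooth_bilinear_sum S B g \<and> (\<forall>x\<in>S. frechet_derivative f (at x) v = g x))"
  using f
proof induction
  case (prod f g)
  have D: "((\<lambda>x. B (f x) (g x)) has_derivative
      (\<lambda>h. B (f x) (frechet_derivative g (at x) h) + B (frechet_derivative f (at x) h) (g x))) (at x)"
    if "x \<in> S" for x
    by (rule bounded_bilinear.FDERIV[OF B smooth_on_has_derivative[OF prod(1) S that]
          smooth_on_has_derivative[OF prod(2) S that]])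
  have "frechet_derivative (\<lambda>x. B (f x) (g x)) (at x) v
      = B (f x) (frechet_derivative g (at x) v) + B (frechet_derivative f (at x) v) (g x)"
    if "x \<in> S" for x v
    using frechet_derivative_at[OF D[OF that]] by metis
  moreover have "smooth_bilinear_sum S B
      (\<lambda>x. B (f x) (frechet_derivative g (at x) v) + B (frechet_derivative f (at x) v) (g x))" for v
    by (intro smooth_bilinear_sum.intros smooth_on_frechet_derivative prod)
  ultimately show ?case using D unfolding differentiable_def by blast
next
  case (add f g)
  have D: "((\<lambda>x. f x + g x) has_derivative
      (\<lambda>h. frechet_derivative f (at x) h + frechet_derivative g (at x) h)) (at x)"
    if "x \<in> S" for x
    using add.IH that by (intro has_derivative_add) (auto simp: frechet_derivative_works)
  have eq: "frechet_derivative (\<lambda>x. f x + g x) (at x) v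
      = frechet_derivative f (at x) v + frechet_derivative g (at x) v" if "x \<in> S" for x v
    using frechet_derivative_at[OF D[OF that]] by metis
  have "\<exists>h. smooth_bilinear_sum S B h \<and> (\<forall>x\<in>S. frechet_derivative (\<lambda>x. f x + g x) (at x) v = h x)" for v
  proof -
    obtain f' g' where "smooth_bilinear_sum S B f'" "smooth_bilinear_sum S B g'"
      "\<forall>x\<in>S. frechet_derivative f (at x) v = f' x" "\<forall>x\<in>S. frechet_derivative g (at x) v = g' x"
      using add.IH by metis
    then show ?thesis
      using eq by (intro exI[of _ "\<lambda>x. f' x + g' x"]) (auto intro: smooth_bilinear_sum.add)
  qed
  then show ?case using D unfolding differentiable_def by blast
qed

lemma smooth_on_bounded_bilinear:
  assumes B: "bounded_bilinear B" and S: "open S" and fg: "smooth_on S f" "smooth_on S g"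
  shows "smooth_on S (\<lambda>x. B (f x) (g x))"
  by (rule smooth_on_coinduct[where P = "smooth_bilinear_sum S B", OF S])
     (use smooth_bilinear_sum_derivative[OF B S] in \<open>blast intro: smooth_bilinear_sum.prod fg\<close>)+

section \<open>Block matrices\<close>

lemma linear_matrix_mult_left: "linear (\<lambda>A. A ** (B :: 'a::real_algebra_1^'p^'m::finite))"
  by (rule linearI) (auto simp: vec_eq_iff matrix_matrix_mult_def sum.distrib scaleR_sum_right distrib_right)

lemma linear_matrix_mult_right: "linear (\<lambda>B. (A :: 'a::real_algebra_1^'m::finite^'n) ** B)"
  by (rule linearI) (auto simp: vec_eq_iff matrix_matrix_mult_def sum.distrib scaleR_sum_right distrib_left)

lemma bounded_bilinear_matrix_mult:
  "bounded_bilinear ((**) :: 'a::{euclidean_space,real_algebra_1}^'m^'n \<Rightarrow> 'a^'p^'m \<Rightarrow> 'a^'p^'n)"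
  by (simp add: bilinear_def linear_matrix_mult_left linear_matrix_mult_right
      flip: bilinear_conv_bounded_bilinear)

lemma linear_transpose: "linear (transpose :: 'a::real_vector^'m^'n \<Rightarrow> 'a^'n^'m)"
  by (rule linearI) (auto simp: vec_eq_iff transpose_def)

text \<open>\<open>matrix_inv\<close> is defined by choice. For square matrices over a field a
  one-sided inverse is two-sided, hence unique, and so it is the chosen one.\<close>

lemma matrix_inv_eqI:
  fixes A B :: "'a::field^'n^'n"
  assumes "B ** A = mat 1"
  shows "matrix_inv A = B"
proof -
  have "A ** B = mat 1" using assms matrix_left_right_inverse by blast
  then have "invertible A" using assms invertible_def by blast
  then have "matrix_inv A ** A = mat 1 \<and> A ** matrix_inv A = mat 1"
    unfolding matrix_inv_def invertible_def by (metis (mono_tags, lifting) someI_ex)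
  then show ?thesis
    using \<open>A ** B = mat 1\<close> by (metis matrix_mul_assoc matrix_mul_lid matrix_mul_rid)
qed

lemma matrix_minus_left: "(- A) ** B = - (A ** (B :: 'a::ring_1^'p^'m::finite))"
  by (simp add: vec_eq_iff matrix_matrix_mult_def sum_negf)

lemma matrix_minus_right: "A ** (- B) = - (A ** (B :: 'a::ring_1^'p^'m::finite))"
  by (simp add: vec_eq_iff matrix_matrix_mult_def sum_negf)

lemma matrix_vector_minus_left: "(- A) *v x = - (A *v (x :: 'a::ring_1^'m::finite))"
  by (simp add: vec_eq_iff matrix_vector_mult_def sum_negf)

lemma matrix_add_rdistrib: "(A + B) ** C = A ** C + B ** (C :: 'a::semiring_1^'p^'m::finite)"
  by (simp add: vec_eq_iff matrix_matrix_mult_def sum.distrib distrib_right)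

lemma matrix_mult_zero [simp]:
  "(0 :: 'a::semiring_1^'m::finite^'n) ** A = 0" "A ** (0 :: 'a^'p^'m) = 0"
  by (simp_all add: vec_eq_iff matrix_matrix_mult_def)

lemma transpose_zero [simp]: "transpose 0 = 0"
  by (simp add: vec_eq_iff transpose_def)

section \<open>Block calculus over a sum index type\<close>

lemma sum_UNIV_Plus:
  "(\<Sum>p\<in>(UNIV :: ('a::finite + 'b::finite) set). f p) = (\<Sum>i\<in>UNIV. f (Inl i)) + (\<Sum>i\<in>UNIV. f (Inr i))"
  by (simp add: sum.Plus flip: UNIV_Plus_UNIV)

lemma all_sum: "(\<forall>p. P p) \<longleftrightarrow> (\<forall>i. P (Inl i)) \<and> (\<forall>i. P (Inr i))"
  by (metis sumE)

lemma blk_nth [simp]: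
  "blk A B C D $ Inl i $ Inl j = A $ i $ j" "blk A B C D $ Inl i $ Inr j = B $ i $ j"
  "blk A B C D $ Inr i $ Inl j = C $ i $ j" "blk A B C D $ Inr i $ Inr j = D $ i $ j"
  by (simp_all add: blk_def)

lemma blk_eq_iff: "X = Z \<longleftrightarrow>
    (\<forall>i j. X $ Inl i $ Inl j = Z $ Inl i $ Inl j) \<and> (\<forall>i j. X $ Inl i $ Inr j = Z $ Inl i $ Inr j) \<and>
    (\<forall>i j. X $ Inr i $ Inl j = Z $ Inr i $ Inl j) \<and> (\<forall>i j. X $ Inr i $ Inr j = Z $ Inr i $ Inr j)"
  unfolding vec_eq_iff all_sum by blast

lemma blk_inject: "blk A B C D = blk A' B' C' D' \<longleftrightarrow> A = A' \<and> B = B' \<and> C = C' \<and> D = D'"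
  unfolding blk_eq_iff[of "blk A B C D"] by (simp add: vec_eq_iff)

lemma blk_add: "blk A B C D + blk A' B' C' D' = blk (A + A') (B + B') (C + C') (D + D')"
  by (simp add: blk_eq_iff)

lemma blk_mult:
  fixes A :: "'a::semiring_1^'n::finite^'n"
  shows "blk A B C D ** blk A' B' C' D' =
    blk (A ** A' + B ** C') (A ** B' + B ** D') (C ** A' + D ** C') (C ** B' + D ** D')"
  by (simp add: blk_eq_iff matrix_matrix_mult_def sum_UNIV_Plus)

lemma blk_transpose: "transpose (blk A B C D) = blk (transpose A) (transpose C) (transpose B) (transpose D)"
  by (simp add: blk_eq_iff transpose_def)

lemma blk_one: "(mat 1 :: 'a::semiring_1^('n::finite + 'n)^('n + 'n)) = blk (mat 1) 0 0 (mat 1)"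
  by (auto simp: blk_eq_iff mat_def)

section \<open>Complexified real matrices, the forms \<open>J\<close> and \<open>G\<close>, and the
  reflection\<close>

lemma cmat_nth [simp]: "cmat A $ i $ j = of_real (A $ i $ j)"
  by (simp add: cmat_def)

lemma cmat_eq_iff: "cmat A = cmat B \<longleftrightarrow> A = B"
  by (simp add: vec_eq_iff)

lemma cmat_mult: "cmat (A ** B) = cmat A ** cmat B"
  by (simp add: vec_eq_iff matrix_matrix_mult_def)

lemma cmat_add: "cmat (A + B) = cmat A + cmat B"
  by (simp add: vec_eq_iff)

lemma cmat_minus: "cmat (- A) = - cmat A"
  by (simp add: vec_eq_iff)

lemma cmat_zero: "cmat 0 = 0"
  by (simp add: vec_eq_iff)

lemma cmat_one: "cmat (mat 1) = mat 1"
  by (simp add: vec_eq_iff mat_def)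

lemma cmat_transpose: "cmat (transpose A) = transpose (cmat A)"
  by (simp add: vec_eq_iff transpose_def)

lemma Jmat_transpose [simp]: "transpose (Jmat k) = Jmat k"
  by (simp add: vec_eq_iff transpose_def Jmat_def)

lemma eps_square [simp]: "eps k i * eps k i = 1"
  by (simp add: eps_def)

lemma Jmat_mult_nth: "(Jmat k ** A) $ i $ j = eps k i * A $ i $ j"
  by (simp add: matrix_matrix_mult_def Jmat_def mult_delta_left)

lemma Jmat_mult_self [simp]: "Jmat k ** Jmat k = mat 1"
  by (auto simp: vec_eq_iff Jmat_mult_nth) (auto simp: Jmat_def mat_def)

lemma Jmat_vector_nth: "(Jmat k *v x) $ i = eps k i * x $ i"
  by (simp add: matrix_vector_mult_def Jmat_def mult_delta_left)

lemma eii_vector: "eii i *v x = x $ i *\<^sub>R axis i 1"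
  by (auto simp: vec_eq_iff matrix_vector_mult_def eii_def axis_def mult_delta_left)

lemma Gmat_mult_self: "Gmat k ** Gmat k = mat 1"
  by (simp add: Gmat_def blk_mult blk_one flip: cmat_mult cmat_one)

text \<open>Since \<open>G\<close> is its own inverse, multiplying the group condition by
  \<open>G\<close> exhibits the inverse of \<open>A\<close> as a linear expression in its
  entries.\<close>

lemma O_cplx_left_inverse:
  assumes "O_cplx k A"
  shows "(Gmat k ** transpose A ** Gmat k) ** A = mat 1"
  using assms by (simp add: O_cplx_def Gmat_mult_self flip: matrix_mul_assoc)

lemma O_indef_left_inverse:
  assumes "O_indef k g"
  shows "(Jmat k ** transpose g ** Jmat k) ** g = mat 1"
  using assms by (simp add: O_indef_def flip: matrix_mul_assoc)

text \<open>\<open>Inn\<close> is an involution, so it equals its own inverse; multiplying by it on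
  both sides changes signs exactly in the off-diagonal blocks.\<close>

lemma Inn_conj:
  fixes A :: "complex^('n::finite + 'n)^('n + 'n)"
  shows
  "Inn ** A ** matrix_inv Inn = blk (\<chi> i j. A $ Inl i $ Inl j) (\<chi> i j. - A $ Inl i $ Inr j)
     (\<chi> i j. - A $ Inr i $ Inl j) (\<chi> i j. A $ Inr i $ Inr j)"
proof -
  have "Inn ** Inn = (mat 1 :: complex^('n + 'n)^('n + 'n))"
    by (simp add: Inn_def blk_mult blk_one matrix_minus_left matrix_minus_right)
  then have inv: "matrix_inv Inn = (Inn :: complex^('n + 'n)^('n + 'n))"
    by (rule matrix_inv_eqI)
  have A: "A = blk (\<chi> i j. A $ Inl i $ Inl j) (\<chi> i j. A $ Inl i $ Inr j)
     (\<chi> i j. A $ Inr i $ Inl j) (\<chi> i j. A $ Inr i $ Inr j)"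
    by (simp add: blk_eq_iff)
  show ?thesis
    unfolding inv by (subst A) (simp add: Inn_def blk_mult matrix_minus_left matrix_minus_right blk_inject, simp add: vec_eq_iff)
qed

text \<open>The arguments \<open>s\<close> and \<open>t\<close> are \<open>Inl\<close> or
  \<open>Inr\<close> and select the block. Taking real parts gives a map that is linear over the
  reals, so smoothness and derivatives pass to blocks; on real matrices nothing is lost.\<close>

definition re_block :: "('n \<Rightarrow> 'n + 'n) \<Rightarrow> ('n \<Rightarrow> 'n + 'n) \<Rightarrow> complex^('n::finite + 'n)^('n + 'n) \<Rightarrow> real^'n^'n" where
  "re_block s t A = (\<chi> i j. Re (A $ s i $ t j))"

lemma bounded_linear_re_block: "bounded_linear (re_block s t)"
  unfolding linear_conv_bounded_linear[symmetric]
  by (rule linearI) (simp_all add: re_block_def vec_eq_iff)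

lemma re_block_blk_cmat [simp]:
  "re_block Inl Inl (blk (cmat K) B C D) = K" "re_block Inl Inr (blk A (cmat K) C D) = K"
  "re_block Inr Inl (blk A B (cmat K) D) = K" "re_block Inr Inr (blk A B C (cmat K)) = K"
  by (simp_all add: re_block_def vec_eq_iff)

lemma re_block_real:
  assumes "\<And>p q. Im (A $ p $ q) = 0"
  shows "blk (cmat (re_block Inl Inl A)) (cmat (re_block Inl Inr A))
    (cmat (re_block Inr Inl A)) (cmat (re_block Inr Inr A)) = A"
  using assms by (simp add: blk_eq_iff re_block_def complex_eq_iff)

text \<open>The connection form is affine in the spectral parameter. Real \<open>t\<close> suffices
  because the derivative at 0 is later computed along the real axis.\<close>

lemma theta_coef_of_real:
  "theta_coef k F (of_real t) i = theta_coef k F 0 i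
     + t *\<^sub>R blk 0 (cmat (- (eii i ** Jmat k))) (cmat (eii i)) 0"
proof -
  have m: "(mat l ** A) $ a $ b = l * A $ a $ b" for l :: complex and A :: "complex^'n^'n" and a b
    by (simp add: matrix_matrix_mult_def mat_def mult_delta_left)
  show ?thesis by (simp add: theta_coef_def blk_eq_iff m cmat_minus) (simp add: scaleR_conv_of_real)
qed

section \<open>Guichard orthogonal co-ordinate systems from a potential\<close>

text \<open>Isolates the facts on \<open>g1\<close>, \<open>g2\<close> and \<open>Y\<close> from
  which the geometric parts (c), (d) and (e) follow, with no reference to the spectral
  parameter.\<close>

locale frame_potential =
  fixes k :: nat and D :: "(real^('n::{finite,linorder})) set"
    and g1 g2 Y :: "real^('n::{finite,linorder}) \<Rightarrow> real^('n::{finite,linorder})^('n::{finite,linorder})"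
  assumes open_D: "open D"
    and smooth_Y: "smooth_on D Y"
    and continuous_g2: "continuous_on D g2"
    and orthogonal_g1: "x \<in> D \<Longrightarrow> orthogonal_matrix (g1 x)"
    and O_indef_g2: "x \<in> D \<Longrightarrow> O_indef k (g2 x)"
    and derivative_Y: "x \<in> D \<Longrightarrow> (Y has_derivative
      (\<lambda>h. \<Sum>i\<in>UNIV. h $ i *\<^sub>R (- (g1 x ** eii i ** Jmat k ** matrix_inv (g2 x))))) (at x)"
begin

abbreviation "metric_coef c x \<equiv> Jmat k ** matrix_inv (g2 x) *v c"

text \<open>Only the summand with index \<open>i\<close> survives, and \<open>eii i\<close> projects
  the vector \<open>metric_coef c x\<close> to its \<open>i\<close>-th coordinate. The direction is
  thus a column of \<open>g1\<close>, the same for every \<open>c\<close>.\<close>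

lemma pder_Y:
  assumes "x \<in> D"
  shows "pder (\<lambda>x. Y x *v c) x i = (- metric_coef c x $ i) *\<^sub>R (g1 x *v axis i 1)"
proof -
  have "linear (\<lambda>A :: ((real, 'n) vec, 'n) vec. A *v c)"
    by (rule linearI) (simp_all add: matrix_vector_mult_add_rdistrib scaleR_matrix_vector_assoc)
  then have L: "bounded_linear (\<lambda>A :: ((real, 'n) vec, 'n) vec. A *v c)"
    by (simp add: linear_conv_bounded_linear)
  have "pder (\<lambda>x. Y x *v c) x i
      = (\<Sum>j\<in>UNIV. axis i 1 $ j *\<^sub>R (- (g1 x ** eii j ** Jmat k ** matrix_inv (g2 x)))) *v c"
    unfolding pder_def
    using frechet_derivative_at[OF bounded_linear.has_derivative[OF L derivative_Y[OF assms]]]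
    by (simp add: fun_eq_iff)
  also have "(\<Sum>j\<in>UNIV. axis i 1 $ j *\<^sub>R (- (g1 x ** eii j ** Jmat k ** matrix_inv (g2 x))))
      = - (g1 x ** eii i ** Jmat k ** matrix_inv (g2 x))"
    by (simp add: axis_def if_distrib if_distribR cong: if_cong)
  also have "\<dots> *v c = - (g1 x *v (eii i *v metric_coef c x))"
    by (simp only: matrix_vector_minus_left matrix_vector_mul_assoc matrix_mul_assoc)
  finally show ?thesis
    by (simp add: eii_vector matrix_vector_mult_scaleR)
qed

lemma inner_g1:
  assumes "x \<in> D"
  shows "(g1 x *v a) \<bullet> (g1 x *v b) = a \<bullet> b"
proof -
  have "orthogonal_transformation ((*v) (g1 x))"
    using orthogonal_g1[OF assms] by (simp add: orthogonal_transformation_matrix)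
  then show ?thesis by (simp add: orthogonal_transformation_def)
qed

text \<open>The columns of \<open>g1\<close> are orthonormal, so the metric is diagonal and the
  minus sign disappears in the square.\<close>

lemma inner_pder_Y:
  assumes "x \<in> D"
  shows "pder (\<lambda>x. Y x *v c) x i \<bullet> pder (\<lambda>x. Y x *v c) x j = (if i = j then (metric_coef c x $ i)\<^sup>2 else 0)"
  by (simp add: pder_Y[OF assms] inner_g1[OF assms] inner_axis_axis power2_eq_square)

lemma matrix_inv_g2:
  assumes "x \<in> D"
  shows "matrix_inv (g2 x) = Jmat k ** transpose (g2 x) ** Jmat k"
  using matrix_inv_eqI[OF O_indef_left_inverse[OF O_indef_g2[OF assms]]] .

text \<open>The vector \<open>c\<close> can be recovered from its metric coefficients; this provides
  the injectivity behind their linear independence.\<close>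

lemma g2_metric_coef:
  assumes "x \<in> D"
  shows "g2 x *v (Jmat k *v metric_coef c x) = c"
proof -
  have "g2 x ** (Jmat k ** (Jmat k ** matrix_inv (g2 x))) = g2 x ** ((Jmat k ** Jmat k) ** matrix_inv (g2 x))"
    by (simp only: matrix_mul_assoc)
  also have "\<dots> = g2 x ** matrix_inv (g2 x)" by simp
  also have "\<dots> = mat 1"
    using O_indef_left_inverse[OF O_indef_g2[OF assms]] matrix_left_right_inverse
    unfolding matrix_inv_g2[OF assms] by blast
  finally show ?thesis by (simp add: matrix_vector_mul_assoc)
qed

text \<open>The indefinite orthogonal group is closed under inversion: substitute the condition on
  \<open>g2\<close> for the middle factor \<open>J\<close> and cancel
  \<open>g2 x ** h\<close>.\<close>

lemma formk_inverse:
  assumes "x \<in> D"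
  shows "formk k (matrix_inv (g2 x) *v c) (matrix_inv (g2 x) *v c) = formk k c c"
proof -
  define h where "h = matrix_inv (g2 x)"
  have "h ** g2 x = mat 1"
    unfolding h_def matrix_inv_g2[OF assms] by (rule O_indef_left_inverse[OF O_indef_g2[OF assms]])
  then have gh: "g2 x ** h = mat 1" using matrix_left_right_inverse by blast
  have "transpose h ** Jmat k ** h = transpose h ** (transpose (g2 x) ** Jmat k ** g2 x) ** h"
    using O_indef_g2[OF assms] by (simp add: O_indef_def)
  also have "\<dots> = transpose (g2 x ** h) ** Jmat k ** (g2 x ** h)"
    by (simp only: matrix_transpose_mul matrix_mul_assoc)
  finally have *: "transpose h ** Jmat k ** h = Jmat k" by (simp add: gh)
  have "formk k (h *v c) (h *v c) = (c v* transpose h) \<bullet> (Jmat k *v (h *v c))"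
    by (simp add: formk_def)
  also have "\<dots> = c \<bullet> ((transpose h ** Jmat k ** h) *v c)"
    by (simp only: dot_lmul_matrix matrix_vector_mul_assoc matrix_mul_assoc)
  finally show ?thesis by (simp only: * h_def[symmetric] formk_def[of k c])
qed

text \<open>The vector \<open>w\<close> is null along with \<open>c\<close>, because the inverse of
  \<open>g2\<close> preserves the form. Splitting the sum \<open>formk k w w = 0\<close> by the sign
  \<open>eps\<close> is the Guichard condition, and applying \<open>J\<close> does not alter
  squares.\<close>

lemma guichard_metric_coef:
  assumes "x \<in> D" "null_vec k c"
  shows "guichard_metric k (\<lambda>i. (metric_coef c x $ i)\<^sup>2)"
proof -
  define w where "w = matrix_inv (g2 x) *v c"
  define m where "m = CARD('n) - k"
  have sq: "(metric_coef c x $ i)\<^sup>2 = (w $ i)\<^sup>2" for i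
    by (simp add: w_def Jmat_vector_nth power_mult_distrib power2_eq_square[of "eps k i"]
        flip: matrix_vector_mul_assoc)
  have "0 = formk k w w"
    using formk_inverse[OF assms(1)] assms(2) by (simp add: w_def null_vec_def)
  also have "\<dots> = (\<Sum>i\<in>UNIV. eps k i * (w $ i)\<^sup>2)"
    by (simp add: formk_def inner_vec_def Jmat_vector_nth power2_eq_square mult_ac)
  also have "\<dots> = (\<Sum>i\<in>{i. idx i < m} \<union> {i. m \<le> idx i}. eps k i * (w $ i)\<^sup>2)"
    by (rule sum.cong) auto
  also have "\<dots> = (\<Sum>i\<in>{i. idx i < m}. eps k i * (w $ i)\<^sup>2) + (\<Sum>i\<in>{i. m \<le> idx i}. eps k i * (w $ i)\<^sup>2)"
    by (rule sum.union_disjoint) auto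
  also have "\<dots> = (\<Sum>i\<in>{i. idx i < m}. (w $ i)\<^sup>2) - (\<Sum>i\<in>{i. m \<le> idx i}. (w $ i)\<^sup>2)"
    unfolding diff_conv_add_uminus
    by (intro arg_cong2[where f = "(+)"]) (auto simp: eps_def m_def simp flip: sum_negf intro!: sum.cong)
  finally show ?thesis by (simp add: guichard_metric_def sq m_def)
qed

lemma open_nondeg_set:
  assumes "finite V"
  shows "open (nondeg_set k D g2 V)"
proof -
  \<comment> \<open>Replacing the inverse of \<open>g2\<close> by its transpose conjugated with
    \<open>J\<close> makes the coefficients linear in the entries of \<open>g2\<close>, hence
    continuous.\<close>
  have eq: "metric_coef c x $ i = (\<Sum>j\<in>UNIV. g2 x $ j $ i * (Jmat k *v c) $ j)" if "x \<in> D" for c x i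
  proof -
    have "Jmat k ** matrix_inv (g2 x) = (Jmat k ** Jmat k) ** (transpose (g2 x) ** Jmat k)"
      unfolding matrix_inv_g2[OF that] by (simp only: matrix_mul_assoc)
    then have "metric_coef c x = transpose (g2 x) *v (Jmat k *v c)"
      by (simp add: matrix_vector_mul_assoc del: transpose_matrix_vector)
    then show ?thesis by (simp add: vector_matrix_mult_def mult.commute)
  qed
  \<comment> \<open>As \<open>V\<close> is finite, all nonvanishing conditions combine into one
    continuous function being nonzero.\<close>
  let ?f = "\<lambda>x. \<Prod>c\<in>V. \<Prod>i\<in>UNIV. \<Sum>j\<in>UNIV. g2 x $ j $ i * (Jmat k *v c) $ j"
  have "continuous_on D ?f"
    by (intro continuous_intros continuous_g2)
  then have "open (D \<inter> ?f -` (- {0}))"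
    using open_D by (intro continuous_open_preimage) auto
  also have "D \<inter> ?f -` (- {0}) = nondeg_set k D g2 V"
    using assms eq by (auto simp: nondeg_set_def)
  finally show ?thesis .
qed

lemma nondeg_setD:
  assumes "x \<in> nondeg_set k D g2 V" "c \<in> V"
  shows "x \<in> D" "metric_coef c x $ i \<noteq> 0"
  using assms by (auto simp: nondeg_set_def)

text \<open>The set \<open>V\<close> may contain further vectors besides \<open>c\<close>, so that
  several co-ordinate systems live on one common open set.\<close>

lemma orth_coord_Y:
  assumes "finite V" "c \<in> V"
  shows "orth_coord (nondeg_set k D g2 V) (\<lambda>x. Y x *v c)"
  unfolding orth_coord_def
proof (intro conjI ballI allI impI)
  have "linear (\<lambda>A :: ((real, 'n) vec, 'n) vec. A *v c)"
    by (rule linearI) (simp_all add: matrix_vector_mult_add_rdistrib scaleR_matrix_vector_assoc)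
  then have "smooth_on D (\<lambda>x. Y x *v c)"
    by (intro smooth_on_bounded_linear[OF _ open_D smooth_Y]) (simp add: linear_conv_bounded_linear)
  then show "smooth_on (nondeg_set k D g2 V) (\<lambda>x. Y x *v c)"
    by (rule smooth_on_subset) (auto simp: nondeg_set_def)
next
  fix x i assume x: "x \<in> nondeg_set k D g2 V"
  have "pder (\<lambda>x. Y x *v c) x i \<bullet> pder (\<lambda>x. Y x *v c) x i \<noteq> 0"
    using inner_pder_Y[of x c i i] nondeg_setD[OF x assms(2)] by simp
  then show "pder (\<lambda>x. Y x *v c) x i \<noteq> 0" by force
qed (use open_nondeg_set[OF assms(1)] inner_pder_Y nondeg_setD(1)[OF _ assms(2)] in auto)

lemma metric_field_Y:
  assumes "U \<subseteq> D"
  shows "metric_field U (\<lambda>x. Y x *v c) (metric_coef c)"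
  using assms inner_pder_Y by (auto simp: metric_field_def)

lemma guichard_coord_Y:
  assumes "U \<subseteq> D" "null_vec k c"
  shows "guichard_coord k U (\<lambda>x. Y x *v c)"
  using assms guichard_metric_coef by (auto simp: guichard_coord_def inner_pder_Y)

text \<open>Both derivatives are multiples of the same column of \<open>g1\<close>; the factor is
  the quotient of the metric coefficients, whose denominator does not vanish on the set.\<close>

lemma combescure_Y:
  assumes V: "finite V" "c \<in> V" "b \<in> V"
  shows "combescure (nondeg_set k D g2 V) (\<lambda>x. Y x *v c) (\<lambda>x. Y x *v b)"
  unfolding combescure_def
proof (intro conjI ballI allI)
  fix x j assume x: "x \<in> nondeg_set k D g2 V"
  have "pder (\<lambda>x. Y x *v b) x j = (metric_coef b x $ j / metric_coef c x $ j) *\<^sub>R pder (\<lambda>x. Y x *v c) x j"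
    using nondeg_setD[OF x V(2)] by (simp add: pder_Y)
  then show "parallel (pder (\<lambda>x. Y x *v c) x j) (pder (\<lambda>x. Y x *v b) x j)"
    unfolding parallel_def by blast
qed (use V in \<open>auto intro: orth_coord_Y\<close>)

lemma combescure_seq_Y:
  assumes c: "null_basis k c"
  shows "combescure_seq k CARD('n) (nondeg_set k D g2 (c ` {1..CARD('n)})) (\<lambda>i x. Y x *v c i)"
proof -
  define I where "I = {1..CARD('n)}"
  define U where "U = nondeg_set k D g2 (c ` I)"
  have V: "finite (c ` I)" by (simp add: I_def)
  have U: "U \<subseteq> D" by (auto simp: U_def nondeg_set_def)
  \<comment> \<open>The normalised directions do not involve \<open>c i\<close>, so the signed
    functions \<open>metric_coef (c i)\<close> are the consistent choice of metric fields.\<close>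
  have norm: "inverse (metric_coef (c i) x $ j) *\<^sub>R pder (\<lambda>x. Y x *v c i) x j = - (g1 x *v axis j 1)"
    if "i \<in> I" "x \<in> U" for i x j
    using nondeg_setD(2)[of x "c ` I" "c i" j] nondeg_setD(1)[of x "c ` I" "c i"] that by (simp add: U_def pder_Y)
  have "1 \<in> I" by (simp add: I_def Suc_le_eq)
  have inj: "inj (\<lambda>c. metric_coef c x)" if "x \<in> U" for x
    using g2_metric_coef U that by (metis injI subsetD)
  have "combescure_seq k CARD('n) U (\<lambda>i x. Y x *v c i)"
    unfolding combescure_seq_def I_def[symmetric]
  proof (intro conjI exI[of _ "\<lambda>i. metric_coef (c i)"] ballI allI impI)
    fix i assume i: "i \<in> I"
    show "orth_coord U (\<lambda>x. Y x *v c i)" using i V by (simp add: U_def orth_coord_Y)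
    show "guichard_coord k U (\<lambda>x. Y x *v c i)"
      using c i U by (simp add: guichard_coord_Y null_basis_def I_def)
    show "metric_field U (\<lambda>x. Y x *v c i) (metric_coef (c i))" using U by (rule metric_field_Y)
    fix x j assume "x \<in> U"
    then show "inverse (metric_coef (c i) x $ j) *\<^sub>R pder (\<lambda>x. Y x *v c i) x j
        = inverse (metric_coef (c 1) x $ j) *\<^sub>R pder (\<lambda>x. Y x *v c 1) x j"
      using norm i \<open>1 \<in> I\<close> by simp
  next
    fix i assume "1 \<le> i \<and> i < CARD('n)"
    then show "combescure U (\<lambda>x. Y x *v c i) (\<lambda>x. Y x *v c (Suc i))"
      unfolding U_def by (intro combescure_Y V) (auto simp: I_def)
  next
    fix x assume x: "x \<in> U"
    have injc: "inj_on c I" using c by (simp add: null_basis_def I_def)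
    show "inj_on (\<lambda>i. metric_coef (c i) x) I"
    proof (rule inj_onI)
      fix i j assume ij: "i \<in> I" "j \<in> I" and "metric_coef (c i) x = metric_coef (c j) x"
      then have "c i = c j" using injD[OF inj[OF x]] by blast
      then show "i = j" using inj_onD[OF injc] ij by blast
    qed
    \<comment> \<open>At fixed \<open>x\<close> the metric fields are the image of the basis under
      one injective linear map.\<close>
    have "independent ((\<lambda>c. metric_coef c x) ` c ` I)"
    proof (rule linear_independent_injective_image)
      show "linear (\<lambda>c. metric_coef c x)" by (rule matrix_vector_mul_linear)
      show "independent (c ` I)" using c by (simp add: null_basis_def I_def)
      show "inj_on (\<lambda>c. metric_coef c x) (span (c ` I))" by (rule inj_on_subset[OF inj[OF x] subset_UNIV])
    qed
    then show "independent ((\<lambda>i. metric_coef (c i) x) ` I)" by (simp add: image_image)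
  qed
  then show ?thesis by (simp add: U_def I_def)
qed

end

section \<open>The extended frame at the origin of the spectral parameter\<close>

lemma has_vector_derivative_snd_slice:
  fixes f :: "'a::real_normed_vector \<times> complex \<Rightarrow> 'b::real_normed_vector"
  assumes "(f has_derivative f') (at (x, 0))"
  shows "((\<lambda>t. f (x, of_real t)) has_vector_derivative f' (0, 1)) (at 0)"
proof -
  have "((\<lambda>t. (x, complex_of_real t)) has_derivative (\<lambda>s. (0, of_real s))) (at 0)"
    by (intro derivative_intros)
  then have "((\<lambda>t. f (x, of_real t)) has_derivative (\<lambda>s. f' (0, of_real s))) (at 0)"
    using has_derivative_compose[of "\<lambda>t. (x, complex_of_real t)" _ 0 UNIV f f'] assms by simp
  moreover have "f' (0, of_real s) = s *\<^sub>R f' (0, 1)" for s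
    using linear_scale[OF has_derivative_linear[OF assms], of s "(0, 1)"] by (simp add: scaleR_conv_of_real)
  ultimately show ?thesis by (simp add: has_vector_derivative_def)
qed

lemma has_derivative_fst_slice:
  assumes "(f has_derivative f') (at (x, l))"
  shows "((\<lambda>y. f (y, l)) has_derivative (\<lambda>h. f' (h, 0))) (at x)"
proof -
  have "((\<lambda>y. (y, l)) has_derivative (\<lambda>h. (h, 0))) (at x)"
    by (intro derivative_intros)
  from has_derivative_compose[OF this, of f f'] assms show ?thesis by simp
qed

text \<open>Reversing the argument negates the derivative but leaves \<open>f\<close> unchanged.
  Below this serves for the even blocks of the frame and also for constant functions.\<close>

lemma has_vector_derivative_even_eq_0:
  fixes f :: "real \<Rightarrow> 'a::real_normed_vector"
  assumes f: "(f has_vector_derivative d) (at 0)" and even: "\<And>t. f (- t) = f t"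
  shows "d = 0"
proof -
  have "(uminus has_derivative uminus) (at (0 :: real))"
    by (intro derivative_intros)
  from has_derivative_compose[OF this, of f "\<lambda>s. s *\<^sub>R d"] f
  have "(f has_vector_derivative - d) (at 0)"
    by (simp add: has_vector_derivative_def even)
  then have "d = - d" using f vector_derivative_unique_at by blast
  then have "2 *\<^sub>R d = 0" by (metis add.right_inverse scaleR_2)
  then show ?thesis by simp
qed

lemma bounded_linear_entry: "bounded_linear (\<lambda>A :: 'a::real_normed_vector^'m^'n. A $ p $ q)"
  by (intro bounded_linear_compose[OF bounded_linear_vec_nth bounded_linear_vec_nth])

lemma bounded_linear_pair_0: "bounded_linear (\<lambda>x :: 'a::real_normed_vector. (x, 0 :: complex))"
  by (intro bounded_linear_Pair bounded_linear_ident bounded_linear_zero)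

locale extended_frame_on =
  fixes k D F E
  assumes open_D: "open D" and frame: "extended_frame k D F E"
begin

text \<open>The derivative in the spectral parameter is taken as a directional derivative of the
  joint map on the product space, which allows it to be exchanged with the derivatives in
  \<open>x\<close>.\<close>

definition "E_lambda x = frechet_derivative (\<lambda>(x, l). E x l) (at (x, 0)) (0, 1)"
definition "E_log x = E_lambda x ** matrix_inv (E x 0)"
text \<open>Here and for \<open>g2\<close> and \<open>Y\<close> real parts of blocks are taken by
  definition; that they capture the full complex blocks is shown in \<open>E0_blk\<close> and
  \<open>E_log_blk\<close>.\<close>

definition "g1 x = re_block Inl Inl (E x 0)"
definition "g2 x = re_block Inr Inr (E x 0)"
definition "Y x = re_block Inl Inr (E_log x)"

lemma smooth_E: "smooth_on (D \<times> UNIV) (\<lambda>(x, l). E x l)"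
  using frame by (simp add: extended_frame_def)

lemma open_domain: "open (D \<times> (UNIV :: complex set))"
  using open_D by (simp add: open_Times)

lemma E_has_derivative:
  assumes "x \<in> D"
  shows "((\<lambda>(x, l). E x l) has_derivative frechet_derivative (\<lambda>(x, l). E x l) (at (x, l))) (at (x, l))"
  using smooth_on_has_derivative[OF smooth_E open_domain] assms by blast

lemma E_curve:
  assumes "x \<in> D"
  shows "((\<lambda>t. E x (of_real t)) has_vector_derivative E_lambda x) (at 0)"
  using has_vector_derivative_snd_slice[OF E_has_derivative[OF assms]] by (simp add: E_lambda_def)

lemma matrix_inv_E:
  assumes "x \<in> D"
  shows "matrix_inv (E x l) = Gmat k ** transpose (E x l) ** Gmat k"
    and "matrix_inv (E x l) ** E x l = mat 1" and "E x l ** matrix_inv (E x l) = mat 1"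
proof -
  have "(Gmat k ** transpose (E x l) ** Gmat k) ** E x l = mat 1"
    using frame assms by (intro O_cplx_left_inverse) (simp add: extended_frame_def)
  then show "matrix_inv (E x l) = Gmat k ** transpose (E x l) ** Gmat k"
    and "matrix_inv (E x l) ** E x l = mat 1" and "E x l ** matrix_inv (E x l) = mat 1"
    using matrix_inv_eqI matrix_left_right_inverse by metis+
qed

lemma E_lambda_entry:
  assumes "x \<in> D"
  shows "((\<lambda>t. E x (of_real t) $ p $ q) has_vector_derivative E_lambda x $ p $ q) (at 0)"
  by (rule bounded_linear.has_vector_derivative[OF bounded_linear_entry E_curve[OF assms]])

text \<open>Restricted to the real axis, the complex derivative of a holomorphic entry is its real
  derivative, and that is unique.\<close>

lemma dlam_eq:
  assumes "x \<in> D"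
  shows "dlam E x = E_lambda x"
proof -
  have "deriv (\<lambda>l. E x l $ p $ q) 0 = E_lambda x $ p $ q" for p q
  proof -
    have "(\<lambda>l. E x l $ p $ q) holomorphic_on UNIV"
      using frame assms by (simp add: extended_frame_def)
    then have "((\<lambda>l. E x l $ p $ q) has_field_derivative deriv (\<lambda>l. E x l $ p $ q) 0) (at (of_real 0))"
      by (auto intro: holomorphic_derivI)
    from has_vector_derivative_real_field[OF this, of UNIV] show ?thesis
      using vector_derivative_unique_at[OF E_lambda_entry[OF assms]] by force
  qed
  then show ?thesis by (simp add: dlam_def vec_eq_iff)
qed

lemma E_partial:
  assumes "x \<in> D"
  shows "frechet_derivative (\<lambda>(x, l). E x l) (at (x, l)) (axis i 1, 0) = E x l ** theta_coef k (F x) l i"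
proof -
  have "((\<lambda>y. E y l) has_derivative (\<lambda>h. frechet_derivative (\<lambda>(x, l). E x l) (at (x, l)) (h, 0))) (at x)"
    using has_derivative_fst_slice[OF E_has_derivative[OF assms, of l]] by simp
  from frechet_derivative_at[OF this]
  have "frechet_derivative (\<lambda>(x, l). E x l) (at (x, l)) (axis i 1, 0) = pder (\<lambda>y. E y l) x i"
    unfolding pder_def by metis
  also have "\<dots> = E x l ** (matrix_inv (E x l) ** pder (\<lambda>y. E y l) x i)"
    by (simp add: matrix_mul_assoc matrix_inv_E(3)[OF assms])
  also have "\<dots> = E x l ** theta_coef k (F x) l i"
    using frame assms by (simp add: extended_frame_def)
  finally show ?thesis .
qed

text \<open>The derivative of the connection form in the spectral parameter, a constant matrix by
  \<open>theta_coef_of_real\<close>.\<close>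

abbreviation "theta_lambda i \<equiv> blk 0 (cmat (- (eii i ** Jmat k))) (cmat (eii i)) 0"

lemma E_lambda_has_derivative:
  assumes x: "x \<in> D"
  shows "(E_lambda has_derivative (\<lambda>h. frechet_derivative
    (\<lambda>p. frechet_derivative (\<lambda>(x, l). E x l) (at p) (0, 1)) (at (x, 0)) (h, 0))) (at x)"
  unfolding E_lambda_def
  using smooth_on_has_derivative[OF smooth_on_frechet_derivative[OF smooth_E] open_domain, of "(x, 0)"] x
  by (intro has_derivative_fst_slice) blast

text \<open>Exchange the two derivatives of the joint map, replace the inner one by the frame
  equation, and apply the product rule in the spectral parameter.\<close>

lemma E_lambda_partial:
  assumes x: "x \<in> D"
  shows "frechet_derivative E_lambda (at x) (axis i 1)
    = E_lambda x ** theta_coef k (F x) 0 i + E x 0 ** theta_lambda i"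
proof -
  \<comment> \<open>\<open>P v\<close> is the derivative in a fixed direction as a function of the
    base point, the form in which \<open>frechet_derivative_swap\<close> applies.\<close>
  define P where "P v = (\<lambda>p. frechet_derivative (\<lambda>(x, l). E x l) (at p) v)" for v
  have xD: "(x, 0) \<in> D \<times> (UNIV :: complex set)" using x by simp
  have P: "(P v has_derivative frechet_derivative (P v) (at (x, 0))) (at (x, 0))" for v
    unfolding P_def
    by (rule smooth_on_has_derivative[OF smooth_on_frechet_derivative[OF smooth_E] open_domain xD])
  have "frechet_derivative E_lambda (at x) (axis i 1) = frechet_derivative (P (0, 1)) (at (x, 0)) (axis i 1, 0)"
    using frechet_derivative_at[OF E_lambda_has_derivative[OF x]] unfolding P_def by metis
  also have "\<dots> = frechet_derivative (P (axis i 1, 0)) (at (x, 0)) (0, 1)"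
    using frechet_derivative_swap[OF open_domain xD smooth_on_differentiable[OF smooth_E open_domain]
        P[unfolded P_def] P[unfolded P_def]] by (simp add: P_def)
  also have "\<dots> = E_lambda x ** theta_coef k (F x) 0 i + E x 0 ** theta_lambda i"
  proof -
    have 1: "((\<lambda>t. P (axis i 1, 0) (x, of_real t)) has_vector_derivative
        frechet_derivative (P (axis i 1, 0)) (at (x, 0)) (0, 1)) (at 0)"
      by (rule has_vector_derivative_snd_slice[OF P])
    have eq: "P (axis i 1, 0) (x, of_real t)
        = E x (of_real t) ** (theta_coef k (F x) 0 i + t *\<^sub>R theta_lambda i)" for t
      unfolding P_def E_partial[OF x] theta_coef_of_real ..
    have "((\<lambda>t. theta_coef k (F x) 0 i + t *\<^sub>R theta_lambda i) has_vector_derivative theta_lambda i) (at 0)"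
      by (auto intro!: derivative_eq_intros)
    from bounded_bilinear.has_vector_derivative[OF bounded_bilinear_matrix_mult E_curve[OF x] this]
    have "((\<lambda>t. P (axis i 1, 0) (x, of_real t)) has_vector_derivative
        E x 0 ** theta_lambda i + E_lambda x ** theta_coef k (F x) 0 i) (at 0)"
      by (simp add: eq)
    from vector_derivative_unique_at[OF 1 this] show ?thesis by (simp add: add.commute)
  qed
  finally show ?thesis .
qed

lemma E_log_mult_E: "x \<in> D \<Longrightarrow> E_log x ** E x 0 = E_lambda x"
  by (simp add: E_log_def matrix_inv_E(2) flip: matrix_mul_assoc)

lemma smooth_slice:
  assumes "smooth_on (D \<times> (UNIV :: complex set)) f"
  shows "smooth_on D (\<lambda>x. f (x, 0))"
  by (rule smooth_on_compose_bounded_linear[OF bounded_linear_pair_0 open_domain open_D _ assms]) auto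

lemma smooth_E0: "smooth_on D (\<lambda>x. E x 0)"
  using smooth_slice[OF smooth_E] by simp

lemma smooth_E_lambda: "smooth_on D E_lambda"
  unfolding E_lambda_def by (rule smooth_slice[OF smooth_on_frechet_derivative[OF smooth_E]])

text \<open>On \<open>D\<close> the inverse of the frame is \<open>G\<close> times its transpose
  times \<open>G\<close>, so smoothness follows from bilinearity without differentiating an
  inverse.\<close>

lemma smooth_E_log: "smooth_on D E_log"
proof (rule smooth_on_cong[OF open_D])
  show "E_lambda x ** (Gmat k ** transpose (E x 0) ** Gmat k) = E_log x" if "x \<in> D" for x
    using that by (simp add: E_log_def matrix_inv_E(1))
  have "linear (\<lambda>A. Gmat k ** transpose A ** Gmat k)"
    using linear_compose[OF linear_compose[OF linear_transpose linear_matrix_mult_right] linear_matrix_mult_left]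
    by (simp add: o_def)
  then have "smooth_on D (\<lambda>x. Gmat k ** transpose (E x 0) ** Gmat k)"
    by (intro smooth_on_bounded_linear[OF _ open_D smooth_E0]) (simp add: linear_conv_bounded_linear)
  then show "smooth_on D (\<lambda>x. E_lambda x ** (Gmat k ** transpose (E x 0) ** Gmat k))"
    by (rule smooth_on_bounded_bilinear[OF bounded_bilinear_matrix_mult open_D smooth_E_lambda])
qed

text \<open>Differentiate \<open>E_log ** E = E_lambda\<close> at \<open>\<lambda> = 0\<close>: the terms containing \<open>theta_coef\<close> cancel.\<close>

lemma E_log_partial:
  assumes x: "x \<in> D"
  shows "frechet_derivative E_log (at x) (axis i 1) = E x 0 ** theta_lambda i ** matrix_inv (E x 0)"
proof -
  have E0: "((\<lambda>y. E y 0) has_derivative (\<lambda>h. frechet_derivative (\<lambda>(x, l). E x l) (at (x, 0)) (h, 0))) (at x)"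
    using has_derivative_fst_slice[OF E_has_derivative[OF x, of 0]] by simp
  have "((\<lambda>y. E_log y ** E y 0) has_derivative
      (\<lambda>h. E_log x ** frechet_derivative (\<lambda>(x, l). E x l) (at (x, 0)) (h, 0)
         + frechet_derivative E_log (at x) h ** E x 0)) (at x)"
    by (rule bounded_bilinear.FDERIV[OF bounded_bilinear_matrix_mult
          smooth_on_has_derivative[OF smooth_E_log open_D x] E0])
  then have "(E_lambda has_derivative
      (\<lambda>h. E_log x ** frechet_derivative (\<lambda>(x, l). E x l) (at (x, 0)) (h, 0)
         + frechet_derivative E_log (at x) h ** E x 0)) (at x)"
    by (rule has_derivative_transform_within_open[OF _ open_D x]) (simp add: E_log_mult_E)
  from frechet_derivative_at[OF this]
  have "frechet_derivative E_lambda (at x) (axis i 1)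
      = E_log x ** (E x 0 ** theta_coef k (F x) 0 i) + frechet_derivative E_log (at x) (axis i 1) ** E x 0"
    unfolding E_partial[OF x, symmetric] by (rule fun_cong[OF sym])
  then have "frechet_derivative E_log (at x) (axis i 1) ** E x 0 = E x 0 ** theta_lambda i"
    unfolding matrix_mul_assoc E_log_mult_E[OF x] E_lambda_partial[OF x] add_left_cancel by (rule sym)
  then have "frechet_derivative E_log (at x) (axis i 1) ** (E x 0 ** matrix_inv (E x 0))
      = E x 0 ** theta_lambda i ** matrix_inv (E x 0)"
    by (simp only: matrix_mul_assoc)
  then show ?thesis by (simp add: matrix_inv_E(3)[OF x])
qed

section \<open>Block structure from reality, reflection and the group condition\<close>

lemma E_real:
  assumes "x \<in> D"
  shows "Im (E x (of_real t) $ p $ q) = 0"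
proof -
  have "(\<chi> a b. cnj (E x (cnj (of_real t)) $ a $ b)) = E x (of_real t)"
    using frame assms unfolding extended_frame_def by blast
  then have "cnj (E x (of_real t) $ p $ q) = E x (of_real t) $ p $ q"
    by (simp add: vec_eq_iff)
  then show ?thesis by (simp add: complex_eq_iff)
qed

lemma E_reflect:
  assumes "x \<in> D"
  shows "E x (- l) $ Inl i $ Inl j = E x l $ Inl i $ Inl j" "E x (- l) $ Inr i $ Inr j = E x l $ Inr i $ Inr j"
    "E x (- l) $ Inl i $ Inr j = - E x l $ Inl i $ Inr j" "E x (- l) $ Inr i $ Inl j = - E x l $ Inr i $ Inl j"
proof -
  have "Inn ** E x (- l) ** matrix_inv Inn = E x l"
    using frame assms unfolding extended_frame_def by blast
  from this[symmetric]
  show "E x (- l) $ Inl i $ Inl j = E x l $ Inl i $ Inl j" "E x (- l) $ Inr i $ Inr j = E x l $ Inr i $ Inr j"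
    "E x (- l) $ Inl i $ Inr j = - E x l $ Inl i $ Inr j" "E x (- l) $ Inr i $ Inl j = - E x l $ Inr i $ Inl j"
    by (simp_all add: Inn_conj)
qed

text \<open>The off-diagonal blocks are odd in the spectral parameter and hence vanish at 0.\<close>

lemma E0_blk:
  assumes "x \<in> D"
  shows "E x 0 = blk (cmat (g1 x)) 0 0 (cmat (g2 x))"
proof -
  have "Im (E x 0 $ p $ q) = 0" for p q using E_real[OF assms, of 0] by simp
  then have "E x 0 = blk (cmat (g1 x)) (cmat (re_block Inl Inr (E x 0)))
      (cmat (re_block Inr Inl (E x 0))) (cmat (g2 x))"
    unfolding g1_def g2_def by (rule re_block_real[symmetric])
  moreover have "re_block Inl Inr (E x 0) = 0" "re_block Inr Inl (E x 0) = 0"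
    using E_reflect(3,4)[OF assms, of 0] by (auto simp: re_block_def vec_eq_iff equal_neg_zero)
  ultimately show ?thesis by (simp add: cmat_zero)
qed

lemma g1_g2_orthogonal:
  assumes "x \<in> D"
  shows "orthogonal_matrix (g1 x)" "O_indef k (g2 x)"
proof -
  have "transpose (E x 0) ** Gmat k ** E x 0 = Gmat k"
    using frame assms by (simp add: extended_frame_def O_cplx_def)
  then have "blk (cmat (transpose (g1 x) ** g1 x)) 0 0 (cmat (transpose (g2 x) ** Jmat k ** g2 x))
      = blk (cmat (mat 1)) 0 0 (cmat (Jmat k))"
    by (simp add: E0_blk[OF assms] Gmat_def blk_transpose blk_mult cmat_mult cmat_transpose cmat_one)
  then show "orthogonal_matrix (g1 x)" "O_indef k (g2 x)"
    by (simp_all add: blk_inject cmat_eq_iff O_indef_def orthogonal_matrix)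
qed

lemma matrix_inv_E0:
  assumes "x \<in> D"
  shows "matrix_inv (E x 0) = blk (cmat (transpose (g1 x))) 0 0 (cmat (matrix_inv (g2 x)))"
proof -
  have "matrix_inv (g2 x) ** g2 x = mat 1"
    using matrix_inv_eqI[OF O_indef_left_inverse] O_indef_left_inverse g1_g2_orthogonal(2)[OF assms] by metis
  then show ?thesis
    using g1_g2_orthogonal(1)[OF assms]
    by (intro matrix_inv_eqI)
       (simp add: E0_blk[OF assms] blk_mult blk_one orthogonal_matrix cmat_one flip: cmat_mult)
qed

text \<open>The diagonal blocks are even in the spectral parameter, so their derivative at 0
  vanishes; imaginary parts vanish along the whole real axis, so the derivative is real.\<close>

lemma E_lambda_blk:
  assumes "x \<in> D"
  shows "E_lambda x = blk 0 (cmat (re_block Inl Inr (E_lambda x))) (cmat (re_block Inr Inl (E_lambda x))) 0"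
proof -
  have "Im (E_lambda x $ p $ q) = 0" for p q
  proof -
    have "((\<lambda>t. Im (E x (of_real t) $ p $ q)) has_vector_derivative Im (E_lambda x $ p $ q)) (at 0)"
      by (rule bounded_linear.has_vector_derivative[OF bounded_linear_Im E_lambda_entry[OF assms]])
    then show ?thesis by (rule has_vector_derivative_even_eq_0) (simp only: E_real[OF assms])
  qed
  then have "E_lambda x = blk (cmat (re_block Inl Inl (E_lambda x))) (cmat (re_block Inl Inr (E_lambda x)))
      (cmat (re_block Inr Inl (E_lambda x))) (cmat (re_block Inr Inr (E_lambda x)))"
    by (rule re_block_real[symmetric])
  moreover have "E_lambda x $ Inl i $ Inl j = 0" "E_lambda x $ Inr i $ Inr j = 0" for i j
    by (rule has_vector_derivative_even_eq_0[OF E_lambda_entry[OF assms]], simp add: E_reflect[OF assms])+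
  then have "re_block Inl Inl (E_lambda x) = 0" "re_block Inr Inr (E_lambda x) = 0"
    by (simp_all add: re_block_def vec_eq_iff)
  ultimately show ?thesis by (simp add: cmat_zero)
qed

text \<open>Differentiating the group condition at 0 and writing
  \<open>E_lambda x = E_log x ** A\<close> gives \<open>transpose A ** W ** A = 0\<close>;
  invertibility of \<open>A\<close> removes the outer factors.\<close>

lemma E_log_skew:
  assumes "x \<in> D"
  shows "transpose (E_log x) ** Gmat k + Gmat k ** E_log x = 0"
proof -
  define A where "A = E x 0"
  define B where "B = matrix_inv A"
  define W where "W = transpose (E_log x) ** Gmat k + Gmat k ** E_log x"
  have AB: "A ** B = mat 1" using matrix_inv_E(3)[OF assms] by (simp add: A_def B_def)
  have 1: "((\<lambda>t. transpose (E x (of_real t))) has_vector_derivative transpose (E_lambda x)) (at 0)"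
    by (rule bounded_linear.has_vector_derivative[OF _ E_curve[OF assms]])
       (simp add: linear_transpose flip: linear_conv_bounded_linear)
  have 2: "((\<lambda>t. Gmat k ** E x (of_real t)) has_vector_derivative Gmat k ** E_lambda x) (at 0)"
    by (rule bounded_linear.has_vector_derivative[OF _ E_curve[OF assms]])
       (simp add: linear_matrix_mult_right flip: linear_conv_bounded_linear)
  have "transpose (E x (of_real t)) ** (Gmat k ** E x (of_real t)) = Gmat k" for t
    using frame assms by (simp add: extended_frame_def O_cplx_def matrix_mul_assoc)
  with bounded_bilinear.has_vector_derivative[OF bounded_bilinear_matrix_mult 1 2]
  have "((\<lambda>t :: real. Gmat k) has_vector_derivative
      transpose A ** (Gmat k ** E_lambda x) + transpose (E_lambda x) ** (Gmat k ** A)) (at 0)"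
    by (simp add: A_def)
  then have "transpose A ** (Gmat k ** E_lambda x) + transpose (E_lambda x) ** (Gmat k ** A) = 0"
    by (rule has_vector_derivative_even_eq_0) simp
  moreover have "E_lambda x = E_log x ** A" using E_log_mult_E[OF assms] by (simp add: A_def)
  ultimately have "transpose A ** W ** A = 0"
    by (simp add: W_def matrix_transpose_mul matrix_mul_assoc matrix_add_ldistrib matrix_add_rdistrib add.commute)
  then have "transpose B ** (transpose A ** W ** A) ** B = 0" by simp
  moreover have "transpose B ** (transpose A ** W ** A) ** B = transpose (A ** B) ** W ** (A ** B)"
    by (simp only: matrix_transpose_mul matrix_mul_assoc)
  ultimately show ?thesis by (simp add: AB W_def)
qed

lemma E_log_blk:
  assumes "x \<in> D"
  shows "E_log x = blk 0 (cmat (Y x)) (cmat (- (Jmat k ** transpose (Y x)))) 0"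
proof -
  obtain Z where Z: "E_log x = blk 0 (cmat (Y x)) (cmat Z) 0"
  proof -
    have "E_log x = blk 0 (cmat (re_block Inl Inr (E_lambda x) ** matrix_inv (g2 x)))
        (cmat (re_block Inr Inl (E_lambda x) ** transpose (g1 x))) 0"
      unfolding E_log_def matrix_inv_E0[OF assms]
      by (subst E_lambda_blk[OF assms]) (simp add: blk_mult cmat_mult)
    moreover from this have "Y x = re_block Inl Inr (E_lambda x) ** matrix_inv (g2 x)"
      by (simp add: Y_def)
    ultimately show ?thesis using that by simp
  qed
  have "blk 0 (cmat (transpose Z ** Jmat k + Y x)) (cmat (transpose (Y x) + Jmat k ** Z)) 0 = blk 0 0 0 0"
    using E_log_skew[OF assms]
    by (simp add: Z Gmat_def blk_transpose blk_mult blk_add cmat_add cmat_mult cmat_transpose)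
       (simp add: blk_eq_iff)
  \<comment> \<open>The lower left block of skewness; multiplying by \<open>J\<close>, which squares
    to the identity, solves it for \<open>Z\<close>.\<close>
  then have "transpose (Y x) + Jmat k ** Z = 0"
    by (simp add: blk_inject cmat_eq_iff flip: cmat_zero)
  then have "Jmat k ** (transpose (Y x) + Jmat k ** Z) = 0" by simp
  then have "Z = - (Jmat k ** transpose (Y x))"
    by (simp add: matrix_add_ldistrib matrix_mul_assoc eq_neg_iff_add_eq_0 add.commute)
  with Z show ?thesis by simp
qed

text \<open>The partial derivatives are the upper right blocks of \<open>theta_lambda i\<close>
  conjugated by the block diagonal matrix \<open>E x 0\<close>; linearity over the standard basis
  assembles them.\<close>

lemma Y_has_derivative:
  assumes x: "x \<in> D"
  shows "(Y has_derivative
    (\<lambda>h. \<Sum>i\<in>UNIV. h $ i *\<^sub>R (- (g1 x ** eii i ** Jmat k ** matrix_inv (g2 x))))) (at x)"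
proof -
  have d: "(E_log has_derivative frechet_derivative E_log (at x)) (at x)"
    by (rule smooth_on_has_derivative[OF smooth_E_log open_D x])
  have Y: "(Y has_derivative (\<lambda>h. re_block Inl Inr (frechet_derivative E_log (at x) h))) (at x)"
    unfolding Y_def by (rule bounded_linear.has_derivative[OF bounded_linear_re_block d])
  have ax: "re_block Inl Inr (frechet_derivative E_log (at x) (axis i 1))
      = - (g1 x ** eii i ** Jmat k ** matrix_inv (g2 x))" for i
  proof -
    have "frechet_derivative E_log (at x) (axis i 1)
        = blk 0 (cmat (- (g1 x ** eii i ** Jmat k ** matrix_inv (g2 x))))
            (cmat (g2 x) ** cmat (eii i) ** cmat (transpose (g1 x))) 0"
      unfolding E_log_partial[OF x] matrix_inv_E0[OF x] unfolding E0_blk[OF x]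
      by (simp add: blk_mult cmat_mult cmat_minus matrix_minus_left matrix_minus_right matrix_mul_assoc)
    then show ?thesis by simp
  qed
  have "re_block Inl Inr (frechet_derivative E_log (at x) h)
      = (\<Sum>i\<in>UNIV. h $ i *\<^sub>R (- (g1 x ** eii i ** Jmat k ** matrix_inv (g2 x))))" for h
  proof -
    interpret l: linear "\<lambda>h. re_block Inl Inr (frechet_derivative E_log (at x) h)"
      using has_derivative_linear[OF Y] .
    have "h = (\<Sum>i\<in>UNIV. h $ i *\<^sub>R axis i 1)"
      using basis_expansion[of h] by (simp add: scalar_mult_eq_scaleR)
    then have "re_block Inl Inr (frechet_derivative E_log (at x) h)
        = (\<Sum>i\<in>UNIV. h $ i *\<^sub>R re_block Inl Inr (frechet_derivative E_log (at x) (axis i 1)))"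
      by (metis (no_types, lifting) l.sum l.scale sum.cong)
    then show ?thesis by (simp add: ax)
  qed
  with Y show ?thesis by simp
qed

text \<open>This transfers the geometric results to the blocks of the frame; continuity of
  \<open>g2\<close> comes from smoothness of \<open>E\<close> at parameter 0.\<close>

sublocale frame_potential k D g1 g2 Y
proof
  show "smooth_on D Y"
    unfolding Y_def by (rule smooth_on_bounded_linear[OF bounded_linear_re_block open_D smooth_E_log])
  have "smooth_on D g2"
    unfolding g2_def by (rule smooth_on_bounded_linear[OF bounded_linear_re_block open_D smooth_E0])
  then show "continuous_on D g2"
    using smooth_on_differentiable[OF _ open_D] differentiable_imp_continuous_within
    by (intro continuous_at_imp_continuous_on) blast
qed (use open_D g1_g2_orthogonal Y_has_derivative in auto)

end

theorem theorem3p2: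
  fixes k :: nat
    and D :: "(real^(('n::{finite,linorder}))) set"
    and F :: "real^('n::{finite,linorder}) \<Rightarrow> real^('n::{finite,linorder})^('n::{finite,linorder})"
    and E :: "real^('n::{finite,linorder}) \<Rightarrow> complex \<Rightarrow> complex^(('n::{finite,linorder})+('n::{finite,linorder}))^(('n::{finite,linorder})+('n::{finite,linorder}))"
  assumes "CARD('n) \<ge> 2" and "1 \<le> k" and "k \<le> CARD('n) - 1"
    and "open D" and "simply_connected D"
    and "is_system_solution k D F"
    and "extended_frame k D F E"
  shows "\<exists>g1 g2 Y.
     (\<forall>x\<in>D. E x 0 = blk (cmat (g1 x)) 0 0 (cmat (g2 x))
            \<and> orthogonal_matrix (g1 x) \<and> O_indef k (g2 x))
   \<and> (\<forall>x\<in>D. dlam E x ** matrix_inv (E x 0)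
              = blk 0 (cmat (Y x)) (cmat (- (Jmat k ** transpose (Y x)))) 0
            \<and> (Y has_derivative
                 (\<lambda>h. \<Sum>i\<in>UNIV. h $ i *\<^sub>R (- (g1 x ** eii i ** Jmat k ** matrix_inv (g2 x))))) (at x))
   \<and> (\<forall>c. null_vec k c \<longrightarrow>
          orth_coord (nondeg_set k D g2 {c}) (\<lambda>x. Y x *v c)
        \<and> metric_field (nondeg_set k D g2 {c}) (\<lambda>x. Y x *v c) (\<lambda>x. Jmat k ** matrix_inv (g2 x) *v c)
        \<and> guichard_coord k (nondeg_set k D g2 {c}) (\<lambda>x. Y x *v c))
   \<and> (\<forall>c. null_basis k c \<longrightarrow>
          combescure_seq k CARD('n) (nondeg_set k D g2 (c ` {1..CARD('n)})) (\<lambda>i x. Y x *v c i))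
   \<and> (\<forall>c b. null_basis k c \<and> null_basis k b \<longrightarrow>
          (\<forall>i\<in>{1..CARD('n)}. \<forall>j\<in>{1..CARD('n)}.
             combescure (nondeg_set k D g2 {c i, b j}) (\<lambda>x. Y x *v c i) (\<lambda>x. Y x *v b j)))"
proof -
  interpret extended_frame_on k D F E
    using assms by unfold_locales
  have sub: "nondeg_set k D g2 V \<subseteq> D" for V by (auto simp: nondeg_set_def)
  \<comment> \<open>The block form is known for \<open>E_lambda\<close>; \<open>dlam_eq\<close>
    restates it for the complex derivative.\<close>
  have "dlam E x ** matrix_inv (E x 0) = blk 0 (cmat (Y x)) (cmat (- (Jmat k ** transpose (Y x)))) 0"
    if "x \<in> D" for x
    using E_log_blk[OF that] by (simp add: E_log_def dlam_eq[OF that])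
  note log = this
  show ?thesis
    by (rule exI[of _ g1], rule exI[of _ g2], rule exI[of _ Y], intro conjI ballI allI impI)
       (rule log E0_blk g1_g2_orthogonal Y_has_derivative orth_coord_Y metric_field_Y[OF sub]
          guichard_coord_Y[OF sub] combescure_seq_Y combescure_Y; simp)+
qed

end
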